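(* For every constant $M>0$ there exists a map $u:\mathbb{R}^2\to\mathbb{S}^2$ with $\nabla u\in L^2$ and $\deg(u)=2$ such that for every $(p,q)\in\mathcal A_2$, $$\int_{\mathbb{R}^2}|\nabla(u-\mathcal S(p/q))|^2> M\big(\mathcal E(u)-8\pi\big).$$
   Context: Identify $\mathbb{R}^2$ with $\mathbb{C}$, $z=x+iy$. The stereographic projection $\mathcal S:\mathbb{C}\cup\{\infty\}\to\mathbb{S}^2$ is $\mathcal S(z)=\frac{1}{1+|z|^2}\big(2\,\mathrm{Re}\,z,\,2\,\mathrm{Im}\,z,\,|z|^2-1\big)$, $\mathcal S(\infty)=(0,0,1)$. For $u:\mathbb{R}^2\to\mathbb{S}^2\subset\mathbb{R}^3$, $\mathcal E(u)=\frac12\int_{\mathbb{R}^2}|\nabla u|^2$, and $\deg(u)=\frac{1}{4\pi}\int_{\mathbb{R}^2}u\cdot(u_y\times u_x)$ is its topological degree. $\mathcal A_2$ is the set of pairs $(p,q)$ of complex polynomials in $z$ such that $p/q$ is irreducible and $\max\{\deg p,\deg q\}=2$; the maps $\mathcal S(p/q)$, $(p,q)\in\mathcal A_2$, are exactly the finite-energy degree 2 harmonic maps $\mathbb{R}^2\to\mathbb{S}^2$, and have energy $8\pi$. *)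

theory Defs
  imports "HOL-Analysis.Analysis" "HOL-Analysis.Cross3" "HOL-Computational_Algebra.Polynomial"
begin

text \<open>R^2 is identified with the complex plane; S^2 is the unit sphere in real^3.\<close>

definition stereo :: "complex \<Rightarrow> real^3" where
  "stereo z = vector [2 * Re z / (1 + (cmod z)\<^sup>2), 2 * Im z / (1 + (cmod z)\<^sup>2),
                      ((cmod z)\<^sup>2 - 1) / (1 + (cmod z)\<^sup>2)]"

text \<open>North pole = stereographic image of infinity.\<close>
definition north_pole :: "real^3" where
  "north_pole = vector [0, 0, 1]"

text \<open>The map S(p/q): at zeros of q (poles of the irreducible fraction p/q) the value is infinity.\<close>
definition stereo_rat :: "complex poly \<Rightarrow> complex poly \<Rightarrow> complex \<Rightarrow> real^3" where
  "stereo_rat p q z = (if poly q z = 0 then north_pole else stereo (poly p z / poly q z))"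

definition A2 :: "(complex poly \<times> complex poly) set" where
  "A2 = {(p, q). coprime p q \<and> max (degree p) (degree q) = 2}"

definition partial_x :: "(complex \<Rightarrow> real^3) \<Rightarrow> complex \<Rightarrow> real^3" where
  "partial_x u z = frechet_derivative u (at z) 1"

definition partial_y :: "(complex \<Rightarrow> real^3) \<Rightarrow> complex \<Rightarrow> real^3" where
  "partial_y u z = frechet_derivative u (at z) \<i>"

definition grad_sq :: "(complex \<Rightarrow> real^3) \<Rightarrow> complex \<Rightarrow> real" where
  "grad_sq u z = (norm (partial_x u z))\<^sup>2 + (norm (partial_y u z))\<^sup>2"

definition dirichlet_energy :: "(complex \<Rightarrow> real^3) \<Rightarrow> real" where
  "dirichlet_energy u = (1/2) * (\<integral>z. grad_sq u z \<partial>lborel)"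

definition map_degree :: "(complex \<Rightarrow> real^3) \<Rightarrow> real" where
  "map_degree u = (1 / (4 * pi)) * (\<integral>z. u z \<bullet> cross3 (partial_y u z) (partial_x u z) \<partial>lborel)"

end

theory Submission
  imports Defs
begin

text \<open>The map \<open>u\<close> carries two concentric bubbles of very different size, both of which pass from the
  south to the north pole, so that on the neck between them \<open>u\<close> has to return from the north to the
  south pole. It does so by turning the sphere through an angle that is a logarithmically slow function
  of \<open>\<bar>z\<bar>\<close>; over scales up to \<open>exp (3 * l)\<close> this costs an energy excess of order \<open>1/l\<close>.

  A rational map \<open>p/q\<close> of degree 2 that is close to \<open>u\<close> would have to be close to \<open>z\<close> for \<open>\<bar>z\<bar>\<close>
  near \<open>1\<close> and to \<open>- z/L\<close> for \<open>\<bar>z\<bar>\<close> near \<open>L = exp (3 * l)\<close>. The first says that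
  \<open>p \<approx> z q\<close> and the second that \<open>p \<approx> - z q/L\<close>; comparing coefficients, these are
  incompatible, which bounds the distance below by a constant that does not depend on \<open>l\<close>.

  Maps to the sphere are written as \<open>hopf P Q\<close>, the image of the point \<open>[P : Q]\<close> of the complex
  projective line; the derivative of \<open>hopf P Q\<close> depends on \<open>dP\<close> and \<open>dQ\<close> only through the form
  \<open>Q dP - P dQ = \<alpha> dz + \<beta> d(cnj z)\<close>. The energy density is a multiple of \<open>\<bar>\<alpha>\<bar>\<^sup>2 + \<bar>\<beta>\<bar>\<^sup>2\<close>, the
  degree density of \<open>\<bar>\<alpha>\<bar>\<^sup>2 - \<bar>\<beta>\<bar>\<^sup>2\<close>, so \<open>\<beta>\<close> alone accounts for the excess.\<close>

section \<open>The Hopf map and its derivative\<close>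

definition triple :: "complex \<Rightarrow> real \<Rightarrow> real^3" where
  "triple c r = vector [Re c, Im c, r]"

lemma triple_nth [simp]:
  "triple c r $ 1 = Re c" "triple c r $ 2 = Im c" "triple c r $ 3 = r"
  by (simp_all add: triple_def)

lemma triple_axis:
  "triple c r = Re c *\<^sub>R axis 1 1 + Im c *\<^sub>R axis 2 1 + r *\<^sub>R axis 3 1"
  by (simp add: vec_eq_iff forall_3 axis_def)

lemma inner_triple: "triple c r \<bullet> triple d s = Re (c * cnj d) + r * s"
  by (simp add: inner_vec_def sum_3)

lemma norm_triple: "(norm (triple c r))\<^sup>2 = (cmod c)\<^sup>2 + r\<^sup>2"
  unfolding power2_norm_eq_inner[of "triple c r"] inner_triple cmod_power2
  by (simp add: power2_eq_square)

lemma scaleR_triple: "a *\<^sub>R triple c r = triple (a *\<^sub>R c) (a * r)"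
  by (simp add: vec_eq_iff forall_3)

lemma has_derivative_triple [derivative_intros]:
  assumes "(f has_derivative f') F" "(g has_derivative g') F"
  shows "((\<lambda>z. triple (f z) (g z)) has_derivative (\<lambda>h. triple (f' h) (g' h))) F"
  unfolding triple_axis
  by (intro derivative_intros assms)

text \<open>In homogeneous coordinates the stereographic projection of \<open>P / Q\<close> stays
  regular where \<open>Q = 0\<close>, so neither the poles of \<open>p / q\<close> nor the points
  where the turned map takes the value infinity need a case distinction.\<close>

definition hopf :: "complex \<Rightarrow> complex \<Rightarrow> real^3" where
  "hopf P Q = triple (2 * P * cnj Q / of_real ((cmod P)\<^sup>2 + (cmod Q)\<^sup>2))
                     (((cmod P)\<^sup>2 - (cmod Q)\<^sup>2) / ((cmod P)\<^sup>2 + (cmod Q)\<^sup>2))"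

text \<open>The tangent vector produced by the projective increment \<open>w = Q dP - P dQ\<close>,
  without the factor 2/N^2, where N = |P|^2 + |Q|^2. Leaving that factor out makes it polynomial in
  \<open>P\<close>, \<open>Q\<close>, \<open>w\<close> and their conjugates, so that its properties
  are ring identities.\<close>

definition hopf_tangent :: "complex \<Rightarrow> complex \<Rightarrow> complex \<Rightarrow> real^3" where
  "hopf_tangent P Q w = triple ((cnj Q)\<^sup>2 * w - P\<^sup>2 * cnj w) (2 * Re (cnj P * cnj Q * w))"

lemma sum_cmod_sq_pos: "P \<noteq> 0 \<or> Q \<noteq> 0 \<Longrightarrow> (cmod P)\<^sup>2 + (cmod Q)\<^sup>2 > 0"
  by (auto intro: add_pos_nonneg add_nonneg_pos)

lemma norm_hopf:
  assumes "P \<noteq> 0 \<or> Q \<noteq> 0"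
  shows "norm (hopf P Q) = 1"
proof -
  define N where "N = (cmod P)\<^sup>2 + (cmod Q)\<^sup>2"
  have N: "N > 0" unfolding N_def using sum_cmod_sq_pos[OF assms] .
  have "(norm (hopf P Q))\<^sup>2 = (2 * cmod P * cmod Q / N)\<^sup>2 + (((cmod P)\<^sup>2 - (cmod Q)\<^sup>2) / N)\<^sup>2"
    using N unfolding hopf_def N_def[symmetric] norm_triple by (simp add: norm_mult norm_divide)
  also have "\<dots> = ((2 * cmod P * cmod Q)\<^sup>2 + ((cmod P)\<^sup>2 - (cmod Q)\<^sup>2)\<^sup>2) / N\<^sup>2"
    by (simp add: power_divide add_divide_distrib)
  also have "(2 * cmod P * cmod Q)\<^sup>2 + ((cmod P)\<^sup>2 - (cmod Q)\<^sup>2)\<^sup>2 = N\<^sup>2"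
    unfolding N_def by algebra
  finally have "(norm (hopf P Q))\<^sup>2 = 1" using N by simp
  then show ?thesis by (simp add: power2_eq_1_iff) (smt (verit) norm_ge_zero)
qed

text \<open>A common rescaling of \<open>P\<close> and \<open>Q\<close> does not move the point on
  the sphere, so only the Wronskian form can survive. The proof applies the quotient rule and then
  compares numerators as polynomials in \<open>P\<close>, \<open>Q\<close>, their increments and
  conjugates.\<close>

lemma has_derivative_hopf:
  assumes P: "(P has_derivative P') (at z)" and Q: "(Q has_derivative Q') (at z)"
    and nz: "P z \<noteq> 0 \<or> Q z \<noteq> 0"
  shows "((\<lambda>z. hopf (P z) (Q z)) has_derivative
     (\<lambda>h. (2 / ((cmod (P z))\<^sup>2 + (cmod (Q z))\<^sup>2)\<^sup>2) *\<^sub>R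
          hopf_tangent (P z) (Q z) (Q z * P' h - P z * Q' h))) (at z)"
proof -
  define N where "N = (\<lambda>z. (cmod (P z))\<^sup>2 + (cmod (Q z))\<^sup>2)"
  have N: "N z > 0" unfolding N_def using sum_cmod_sq_pos[OF nz] .
  have sq: "(cmod c)\<^sup>2 = (Re c)\<^sup>2 + (Im c)\<^sup>2" for c by (rule cmod_power2)
  have dN: "(N has_derivative (\<lambda>h. 2 * Re (cnj (P z) * P' h) + 2 * Re (cnj (Q z) * Q' h))) (at z)"
    unfolding N_def sq by (rule derivative_eq_intros P Q refl | simp add: fun_eq_iff algebra_simps)+
  have dD: "((\<lambda>z. (cmod (P z))\<^sup>2 - (cmod (Q z))\<^sup>2) has_derivative
      (\<lambda>h. 2 * Re (cnj (P z) * P' h) - 2 * Re (cnj (Q z) * Q' h))) (at z)"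
    unfolding sq by (rule derivative_eq_intros P Q refl | simp add: fun_eq_iff algebra_simps)+
  have Nc: "complex_of_real (N z) = P z * cnj (P z) + Q z * cnj (Q z)"
    unfolding N_def by (simp flip: complex_norm_square)
  have d1: "((\<lambda>z. 2 * P z * cnj (Q z) / of_real (N z)) has_derivative
     (\<lambda>h. (2 / (N z)\<^sup>2) *\<^sub>R ((cnj (Q z))\<^sup>2 * (Q z * P' h - P z * Q' h) - (P z)\<^sup>2 * cnj (Q z * P' h - P z * Q' h)))) (at z)"
  proof -
    have d: "((\<lambda>z. 2 * P z * cnj (Q z) / of_real (N z)) has_derivative
     (\<lambda>h. ((2 * P' h * cnj (Q z) + 2 * P z * cnj (Q' h)) * of_real (N z)
           - 2 * P z * cnj (Q z) * of_real (2 * Re (cnj (P z) * P' h) + 2 * Re (cnj (Q z) * Q' h)))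
          / (of_real (N z) * of_real (N z)))) (at z)"
      using N by (auto intro!: derivative_eq_intros P Q dN refl simp: fun_eq_iff algebra_simps)
    have r: "complex_of_real (2 * Re (cnj (P z) * a) + 2 * Re (cnj (Q z) * b))
        = cnj (P z) * a + P z * cnj a + cnj (Q z) * b + Q z * cnj b" for a b
      by (simp add: complex_eq_iff algebra_simps)
    have "((2 * P' h * cnj (Q z) + 2 * P z * cnj (Q' h)) * of_real (N z)
           - 2 * P z * cnj (Q z) * of_real (2 * Re (cnj (P z) * P' h) + 2 * Re (cnj (Q z) * Q' h)))
        = 2 * ((cnj (Q z))\<^sup>2 * (Q z * P' h - P z * Q' h) - (P z)\<^sup>2 * cnj (Q z * P' h - P z * Q' h))" for h
      unfolding r Nc complex_cnj_diff complex_cnj_mult by algebra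
    then show ?thesis using d by (simp add: scaleR_conv_of_real power2_eq_square)
  qed
  have d2: "((\<lambda>z. ((cmod (P z))\<^sup>2 - (cmod (Q z))\<^sup>2) / N z) has_derivative
     (\<lambda>h. (2 / (N z)\<^sup>2) * (2 * Re (cnj (P z) * cnj (Q z) * (Q z * P' h - P z * Q' h))))) (at z)"
  proof -
    have d: "((\<lambda>z. ((cmod (P z))\<^sup>2 - (cmod (Q z))\<^sup>2) / N z) has_derivative
     (\<lambda>h. ((2 * Re (cnj (P z) * P' h) - 2 * Re (cnj (Q z) * Q' h)) * N z
           - ((cmod (P z))\<^sup>2 - (cmod (Q z))\<^sup>2) * (2 * Re (cnj (P z) * P' h) + 2 * Re (cnj (Q z) * Q' h)))
          / (N z * N z))) (at z)"
      using has_derivative_divide'[OF dD dN] N by simp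
    have "((2 * Re (cnj (P z) * a) - 2 * Re (cnj (Q z) * b)) * N z
           - ((cmod (P z))\<^sup>2 - (cmod (Q z))\<^sup>2) * (2 * Re (cnj (P z) * a) + 2 * Re (cnj (Q z) * b)))
        = 2 * (2 * Re (cnj (P z) * cnj (Q z) * (Q z * a - P z * b)))" for a b
    proof -
      have "(cnj (P z) * cnj (Q z) * (Q z * a - P z * b)) =
          of_real ((cmod (Q z))\<^sup>2) * (cnj (P z) * a) - of_real ((cmod (P z))\<^sup>2) * (cnj (Q z) * b)"
        unfolding complex_norm_square by algebra
      then have "Re (cnj (P z) * cnj (Q z) * (Q z * a - P z * b)) =
          (cmod (Q z))\<^sup>2 * Re (cnj (P z) * a) - (cmod (P z))\<^sup>2 * Re (cnj (Q z) * b)"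
        by (simp del: of_real_power)
      then show ?thesis unfolding N_def by algebra
    qed
    then show ?thesis using d by (simp add: power2_eq_square)
  qed
  have "((\<lambda>z. triple (2 * P z * cnj (Q z) / of_real (N z)) (((cmod (P z))\<^sup>2 - (cmod (Q z))\<^sup>2) / N z))
     has_derivative (\<lambda>h. triple
      ((2 / (N z)\<^sup>2) *\<^sub>R ((cnj (Q z))\<^sup>2 * (Q z * P' h - P z * Q' h) - (P z)\<^sup>2 * cnj (Q z * P' h - P z * Q' h)))
      ((2 / (N z)\<^sup>2) * (2 * Re (cnj (P z) * cnj (Q z) * (Q z * P' h - P z * Q' h)))))) (at z)"
    by (rule has_derivative_triple[OF d1 d2])
  then show ?thesis
    unfolding hopf_def hopf_tangent_def N_def scaleR_triple .
qed

text \<open>The differential is conformal: \<open>hopf_tangent P Q\<close> is N times an isometry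
  onto the tangent plane.\<close>

lemma norm_hopf_tangent:
  "(norm (hopf_tangent P Q w))\<^sup>2 = ((cmod P)\<^sup>2 + (cmod Q)\<^sup>2)\<^sup>2 * (cmod w)\<^sup>2"
  unfolding hopf_tangent_def norm_triple cmod_power2
  by (simp add: power2_eq_square) algebra

text \<open>\<open>Im (cnj v * w)\<close> is the signed area spanned by \<open>v\<close> and
  \<open>w\<close>. With \<open>w\<close> taken in the y direction and \<open>v\<close> in the x
  direction, as in \<open>map_degree\<close>, holomorphic maps get a nonnegative density.\<close>

lemma hopf_inner_cross:
  assumes "P \<noteq> 0 \<or> Q \<noteq> 0"
  shows "hopf P Q \<bullet> cross3 (hopf_tangent P Q w) (hopf_tangent P Q v)
       = ((cmod P)\<^sup>2 + (cmod Q)\<^sup>2)\<^sup>2 * Im (cnj v * w)"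
proof -
  define N where "N = (cmod P)\<^sup>2 + (cmod Q)\<^sup>2"
  have N: "N > 0" unfolding N_def using sum_cmod_sq_pos[OF assms] .
  have h: "hopf P Q = (1/N) *\<^sub>R triple (2 * P * cnj Q) ((cmod P)\<^sup>2 - (cmod Q)\<^sup>2)"
    unfolding hopf_def N_def scaleR_triple by (simp add: scaleR_conv_of_real divide_inverse mult.commute)
  have "triple (2 * P * cnj Q) ((cmod P)\<^sup>2 - (cmod Q)\<^sup>2) \<bullet> cross3 (hopf_tangent P Q w) (hopf_tangent P Q v)
     = N^3 * Im (cnj v * w)"
    unfolding hopf_tangent_def N_def cmod_power2
    by (simp add: inner_vec_def sum_3 cross3_def power2_eq_square) algebra
  then show ?thesis unfolding h inner_scaleR_left N_def[symmetric]
    using N by (simp add: power2_eq_square power3_eq_cube)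
qed

section \<open>Energy and degree densities of maps in homogeneous coordinates\<close>

lemma has_derivative_imp_partials:
  assumes "(u has_derivative u') (at z)"
  shows "partial_x u z = u' 1" "partial_y u z = u' \<i>"
  using frechet_derivative_at[OF assms] by (simp_all add: partial_x_def partial_y_def)

lemma grad_sq_cong_open:
  assumes "open S" "z \<in> S" "u differentiable (at z)" "\<And>w. w \<in> S \<Longrightarrow> u w = v w"
  shows "grad_sq u z = grad_sq v z"
  unfolding grad_sq_def partial_x_def partial_y_def
  using frechet_derivative_transform_within_open[OF assms(3,1,2,4)] by simp

text \<open>On the directions 1 and \<i> the form takes the values \<alpha> + \<beta> and
  \<i>(\<alpha> - \<beta>). Conformality reduces the energy to the sum of their squared moduli,
  where the parallelogram law removes the mixed terms; the degree density is their signed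
  area.\<close>

lemma grad_sq_hopf:
  assumes P: "(P has_derivative P') (at z)" and Q: "(Q has_derivative Q') (at z)"
    and nz: "P z \<noteq> 0 \<or> Q z \<noteq> 0"
    and w: "\<And>h. Q z * P' h - P z * Q' h = \<alpha> * h + \<beta> * cnj h"
  shows "grad_sq (\<lambda>z. hopf (P z) (Q z)) z
           = 8 * ((cmod \<alpha>)\<^sup>2 + (cmod \<beta>)\<^sup>2) / ((cmod (P z))\<^sup>2 + (cmod (Q z))\<^sup>2)\<^sup>2"
    and "hopf (P z) (Q z) \<bullet> cross3 (partial_y (\<lambda>z. hopf (P z) (Q z)) z) (partial_x (\<lambda>z. hopf (P z) (Q z)) z)
           = 4 * ((cmod \<alpha>)\<^sup>2 - (cmod \<beta>)\<^sup>2) / ((cmod (P z))\<^sup>2 + (cmod (Q z))\<^sup>2)\<^sup>2"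
proof -
  define N where "N = (cmod (P z))\<^sup>2 + (cmod (Q z))\<^sup>2"
  have N: "N > 0" unfolding N_def using sum_cmod_sq_pos[OF nz] .
  note D = has_derivative_imp_partials[OF has_derivative_hopf[OF P Q nz], unfolded w, folded N_def]
  have "grad_sq (\<lambda>z. hopf (P z) (Q z)) z = (2 / N\<^sup>2)\<^sup>2 * (N\<^sup>2 * ((cmod (\<alpha> + \<beta>))\<^sup>2 + (cmod (\<alpha> * \<i> - \<beta> * \<i>))\<^sup>2))"
    unfolding grad_sq_def D norm_scaleR power_mult_distrib norm_hopf_tangent N_def[symmetric]
    using N by (simp add: algebra_simps)
  also have "(cmod (\<alpha> + \<beta>))\<^sup>2 + (cmod (\<alpha> * \<i> - \<beta> * \<i>))\<^sup>2 = 2 * ((cmod \<alpha>)\<^sup>2 + (cmod \<beta>)\<^sup>2)"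
    unfolding cmod_power2 by (simp add: power2_eq_square algebra_simps)
  finally show "grad_sq (\<lambda>z. hopf (P z) (Q z)) z = 8 * ((cmod \<alpha>)\<^sup>2 + (cmod \<beta>)\<^sup>2) / N\<^sup>2"
    using N by (simp add: power2_eq_square)
  have "hopf (P z) (Q z) \<bullet> cross3 (partial_y (\<lambda>z. hopf (P z) (Q z)) z) (partial_x (\<lambda>z. hopf (P z) (Q z)) z)
     = (2 / N\<^sup>2)\<^sup>2 * (N\<^sup>2 * Im (cnj (\<alpha> + \<beta>) * (\<alpha> * \<i> - \<beta> * \<i>)))"
    unfolding D cross_mult_left cross_mult_right inner_scaleR_right hopf_inner_cross[OF nz] N_def[symmetric]
    using N by (simp add: power2_eq_square)
  also have "Im (cnj (\<alpha> + \<beta>) * (\<alpha> * \<i> - \<beta> * \<i>)) = (cmod \<alpha>)\<^sup>2 - (cmod \<beta>)\<^sup>2"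
    unfolding cmod_power2 by (simp add: power2_eq_square algebra_simps)
  finally show "hopf (P z) (Q z) \<bullet> cross3 (partial_y (\<lambda>z. hopf (P z) (Q z)) z) (partial_x (\<lambda>z. hopf (P z) (Q z)) z)
     = 4 * ((cmod \<alpha>)\<^sup>2 - (cmod \<beta>)\<^sup>2) / N\<^sup>2"
    using N by (simp add: power2_eq_square)
qed

text \<open>Rotating both arguments by \<i> flips the sign of the terms in \<open>w1 * w2\<close>
  and keeps those in \<open>w1 * cnj w2\<close>. What remains is governed by the hermitian product
  of the two homogeneous vectors.\<close>

lemma inner_hopf_tangent:
  "hopf_tangent P1 Q1 w1 \<bullet> hopf_tangent P2 Q2 w2
     + hopf_tangent P1 Q1 (\<i> * w1) \<bullet> hopf_tangent P2 Q2 (\<i> * w2)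
   = 2 * Re (w1 * cnj w2 * (cnj Q1 * Q2 + cnj P1 * P2)\<^sup>2)"
  unfolding hopf_tangent_def inner_triple
  by (simp add: power2_eq_square) algebra

text \<open>Lagrange's identity; it expresses the hermitian product through the determinant, which
  measures how far apart the two points are.\<close>

lemma cmod_hermitian_sq:
  "(cmod (cnj Q1 * Q2 + cnj P1 * P2))\<^sup>2
     = ((cmod P1)\<^sup>2 + (cmod Q1)\<^sup>2) * ((cmod P2)\<^sup>2 + (cmod Q2)\<^sup>2) - (cmod (P1 * Q2 - P2 * Q1))\<^sup>2"
  unfolding cmod_power2 by (simp add: power2_eq_square) algebra

text \<open>Two holomorphic maps at a point: both differentials are conformal, and their inner product loses
  the factor \<open>cos\<^sup>2 (\<theta>/2)\<close>, where \<open>\<theta>\<close> is the angle between the two values on the sphere.\<close>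

lemma grad_sq_diff_hopf_ge:
  assumes P1: "(P1 has_field_derivative P1') (at z)" and Q1: "(Q1 has_field_derivative Q1') (at z)"
    and P2: "(P2 has_field_derivative P2') (at z)" and Q2: "(Q2 has_field_derivative Q2') (at z)"
    and nz1: "P1 z \<noteq> 0 \<or> Q1 z \<noteq> 0" and nz2: "P2 z \<noteq> 0 \<or> Q2 z \<noteq> 0"
  shows "grad_sq (\<lambda>z. hopf (P1 z) (Q1 z) - hopf (P2 z) (Q2 z)) z
     \<ge> 8 * (cmod (Q1 z * P1' - P1 z * Q1'))\<^sup>2 / ((cmod (P1 z))\<^sup>2 + (cmod (Q1 z))\<^sup>2)^3
         * (cmod (P1 z * Q2 z - P2 z * Q1 z))\<^sup>2 / ((cmod (P2 z))\<^sup>2 + (cmod (Q2 z))\<^sup>2)"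
proof -
  define N1 where "N1 = (cmod (P1 z))\<^sup>2 + (cmod (Q1 z))\<^sup>2"
  define N2 where "N2 = (cmod (P2 z))\<^sup>2 + (cmod (Q2 z))\<^sup>2"
  have N: "N1 > 0" "N2 > 0" unfolding N1_def N2_def using sum_cmod_sq_pos nz1 nz2 by blast+
  define w1 where "w1 = Q1 z * P1' - P1 z * Q1'"
  define w2 where "w2 = Q2 z * P2' - P2 z * Q2'"
  define T1 where "T1 = hopf_tangent (P1 z) (Q1 z)"
  define T2 where "T2 = hopf_tangent (P2 z) (Q2 z)"
  have w: "Q1 z * (P1' * h) - P1 z * (Q1' * h) = h * w1" 
          "Q2 z * (P2' * h) - P2 z * (Q2' * h) = h * w2" for h
    unfolding w1_def w2_def by algebra+
  have D: "((\<lambda>z. hopf (P1 z) (Q1 z) - hopf (P2 z) (Q2 z)) has_derivative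
     (\<lambda>h. (2 / N1\<^sup>2) *\<^sub>R T1 (h * w1) - (2 / N2\<^sup>2) *\<^sub>R T2 (h * w2))) (at z)"
    using has_derivative_diff[OF has_derivative_hopf[OF P1[unfolded has_field_derivative_def] Q1[unfolded has_field_derivative_def] nz1]
       has_derivative_hopf[OF P2[unfolded has_field_derivative_def] Q2[unfolded has_field_derivative_def] nz2]]
    unfolding w T1_def T2_def N1_def N2_def .
  define a where "a = cnj (Q1 z) * Q2 z + cnj (P1 z) * P2 z"
  have diff: "(norm (x - y))\<^sup>2 = (norm x)\<^sup>2 + (norm y)\<^sup>2 - 2 * (x \<bullet> y)" for x y :: "real^3"
    by (simp add: power2_norm_eq_inner inner_diff_left inner_diff_right inner_commute)
  have nT: "(norm (T1 w))\<^sup>2 = N1\<^sup>2 * (cmod w)\<^sup>2" "(norm (T2 w))\<^sup>2 = N2\<^sup>2 * (cmod w)\<^sup>2" for w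
    unfolding T1_def T2_def N1_def N2_def by (rule norm_hopf_tangent)+
  define A where "A = cmod w1 / N1"
  define B where "B = cmod w2 / N2"
  \<comment> \<open>\<open>S\<close> is sin^2(\<theta>/2), hence \<open>1 - S\<close> is the factor
    cos^2(\<theta>/2). \<open>A\<close> and \<open>B\<close> are the conformal factors of the two
    maps, up to a constant.\<close>
  define S where "S = (cmod (P1 z * Q2 z - P2 z * Q1 z))\<^sup>2 / (N1 * N2)"
  have "grad_sq (\<lambda>z. hopf (P1 z) (Q1 z) - hopf (P2 z) (Q2 z)) z =
      (norm ((2 / N1\<^sup>2) *\<^sub>R T1 w1 - (2 / N2\<^sup>2) *\<^sub>R T2 w2))\<^sup>2 +
      (norm ((2 / N1\<^sup>2) *\<^sub>R T1 (\<i> * w1) - (2 / N2\<^sup>2) *\<^sub>R T2 (\<i> * w2)))\<^sup>2"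
    unfolding grad_sq_def has_derivative_imp_partials[OF D] by simp
  also have "\<dots> = 2 * ((2 / N1\<^sup>2)\<^sup>2 * (N1\<^sup>2 * (cmod w1)\<^sup>2)) + 2 * ((2 / N2\<^sup>2)\<^sup>2 * (N2\<^sup>2 * (cmod w2)\<^sup>2))
      - 2 * (2 / N1\<^sup>2) * (2 / N2\<^sup>2) * (T1 w1 \<bullet> T2 w2 + T1 (\<i> * w1) \<bullet> T2 (\<i> * w2))"
    unfolding diff norm_scaleR power_mult_distrib nT by (simp add: norm_mult algebra_simps add_divide_distrib)
  also have "T1 w1 \<bullet> T2 w2 + T1 (\<i> * w1) \<bullet> T2 (\<i> * w2) = 2 * Re (w1 * cnj w2 * a\<^sup>2)"
    unfolding T1_def T2_def a_def by (rule inner_hopf_tangent)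
  finally have G: "grad_sq (\<lambda>z. hopf (P1 z) (Q1 z) - hopf (P2 z) (Q2 z)) z =
      8 * A\<^sup>2 + 8 * B\<^sup>2 - 16 * (Re (w1 * cnj w2 * a\<^sup>2) / (N1\<^sup>2 * N2\<^sup>2))"
    using N unfolding A_def B_def by (simp add: power2_eq_square field_simps)
  have aa: "(cmod a)\<^sup>2 = N1 * N2 * (1 - S)"
    unfolding a_def cmod_hermitian_sq S_def using N by (simp add: N1_def[symmetric] N2_def[symmetric] field_simps)
  have "Re (w1 * cnj w2 * a\<^sup>2) \<le> cmod (w1 * cnj w2 * a\<^sup>2)" by (rule complex_Re_le_cmod)
  also have "\<dots> = cmod w1 * cmod w2 * (N1 * N2 * (1 - S))"
    by (simp add: norm_mult norm_power aa)
  finally have "Re (w1 * cnj w2 * a\<^sup>2) / (N1\<^sup>2 * N2\<^sup>2) \<le> cmod w1 * cmod w2 * (N1 * N2 * (1 - S)) / (N1\<^sup>2 * N2\<^sup>2)"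
    using N by (intro divide_right_mono) auto
  also have "\<dots> = A * B * (1 - S)"
    unfolding A_def B_def using N by (simp add: power2_eq_square)
  finally have Gge: "grad_sq (\<lambda>z. hopf (P1 z) (Q1 z) - hopf (P2 z) (Q2 z)) z \<ge> 8 * A\<^sup>2 + 8 * B\<^sup>2 - 16 * (A * B * (1 - S))"
    unfolding G by linarith
  have "0 \<le> (N1 * N2) * (1 - S)" using aa by (metis zero_le_power2)
  moreover have "0 < N1 * N2" using N by simp
  ultimately have "0 \<le> 1 - S" by (simp only: zero_le_mult_iff) linarith
  then have S: "0 \<le> S" "S \<le> 1" using N by (auto simp: S_def)
  \<comment> \<open>Completing the square in \<open>B\<close> gives a bound that holds whatever the
    derivative of the second map is; 1 - (1 - S)^2 is split as S + S(1 - S).\<close>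
  have "8 * A\<^sup>2 + 8 * B\<^sup>2 - 16 * (A * B * (1 - S)) = 8 * A\<^sup>2 * S + 8 * A\<^sup>2 * (S * (1 - S)) + 8 * (B - A * (1 - S))\<^sup>2"
    by (simp add: power2_eq_square algebra_simps)
  also have "\<dots> \<ge> 8 * A\<^sup>2 * S" using S by simp
  finally have "grad_sq (\<lambda>z. hopf (P1 z) (Q1 z) - hopf (P2 z) (Q2 z)) z \<ge> 8 * A\<^sup>2 * S" using Gge by linarith
  moreover have "8 * A\<^sup>2 * S = 8 * (cmod w1)\<^sup>2 / N1^3 * (cmod (P1 z * Q2 z - P2 z * Q1 z))\<^sup>2 / N2"
    unfolding A_def S_def by (simp add: power2_eq_square power3_eq_cube)
  ultimately show ?thesis unfolding w1_def N1_def N2_def by simp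
qed

section \<open>Measurability of the densities and integrability of differences\<close>

lemma tendsto_difference_quotient:
  assumes "(u has_derivative u') (at z)"
  shows "(\<lambda>n. real (Suc n) *\<^sub>R (u (z + v /\<^sub>R real (Suc n)) - u z)) \<longlonglongrightarrow> u' v"
proof (cases "v = 0")
  case True
  then show ?thesis using has_derivative_bounded_linear[OF assms] by (simp add: linear_0 bounded_linear.linear)
next
  case False
  interpret u': bounded_linear u' using has_derivative_bounded_linear[OF assms] .
  have "((\<lambda>y. norm (u y - u z - u' (y - z)) / norm (y - z)) \<longlongrightarrow> 0) (at z)"
    using assms by (simp add: has_derivative_at' has_derivative_iff_norm)
  moreover have "filterlim (\<lambda>n. z + v /\<^sub>R real (Suc n)) (at z) sequentially"
  proof (rule filterlim_atI)
    have "(\<lambda>n. z + inverse (real (Suc n)) *\<^sub>R v) \<longlonglongrightarrow> z + 0 *\<^sub>R v"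
      by (intro tendsto_intros LIMSEQ_inverse_real_of_nat)
    then show "(\<lambda>n. z + v /\<^sub>R real (Suc n)) \<longlonglongrightarrow> z" by simp
  qed (use False in auto)
  ultimately have "(\<lambda>n. norm (u (z + v /\<^sub>R real (Suc n)) - u z - u' (v /\<^sub>R real (Suc n))) / norm (v /\<^sub>R real (Suc n))) \<longlonglongrightarrow> 0"
    by (rule filterlim_compose[THEN filterlim_cong[OF refl refl, THEN iffD1, rotated]]) auto
  then have "(\<lambda>n. norm v * (norm (u (z + v /\<^sub>R real (Suc n)) - u z - u' (v /\<^sub>R real (Suc n))) / norm (v /\<^sub>R real (Suc n)))) \<longlonglongrightarrow> norm v * 0"
    by (intro tendsto_intros)
  moreover have "norm v * (norm (u (z + v /\<^sub>R real (Suc n)) - u z - u' (v /\<^sub>R real (Suc n))) / norm (v /\<^sub>R real (Suc n)))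
      = norm (real (Suc n) *\<^sub>R (u (z + v /\<^sub>R real (Suc n)) - u z) - u' v)" for n
  proof -
    have "real (Suc n) *\<^sub>R (u (z + v /\<^sub>R real (Suc n)) - u z) - u' v
       = real (Suc n) *\<^sub>R (u (z + v /\<^sub>R real (Suc n)) - u z - u' (v /\<^sub>R real (Suc n)))"
      by (simp add: u'.scaleR scaleR_diff_right del: of_nat_Suc)
    then show ?thesis using False by (simp add: divide_inverse del: of_nat_Suc)
  qed
  ultimately show ?thesis by (simp add: tendsto_norm_zero_iff LIM_zero_cancel del: of_nat_Suc)
qed

text \<open>The derivative in direction \<open>v\<close> is the pointwise limit of the continuous
  difference quotients with increments v/(n+1).\<close>

lemma borel_measurable_frechet_derivative:
  fixes u :: "complex \<Rightarrow> real^3"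
  assumes "\<And>z. u differentiable (at z)"
  shows "(\<lambda>z. frechet_derivative u (at z) v) \<in> borel_measurable borel"
proof (rule borel_measurable_LIMSEQ_metric)
  have c: "continuous_on UNIV u"
    using assms by (meson continuous_at_imp_continuous_on differentiable_imp_continuous_within)
  show "(\<lambda>z. real (Suc n) *\<^sub>R (u (z + v /\<^sub>R real (Suc n)) - u z)) \<in> borel_measurable borel" for n
    by (intro borel_measurable_continuous_onI continuous_intros continuous_on_compose2[OF c]) auto
  show "(\<lambda>n. real (Suc n) *\<^sub>R (u (z + v /\<^sub>R real (Suc n)) - u z)) \<longlonglongrightarrow> frechet_derivative u (at z) v" for z
    using assms by (intro tendsto_difference_quotient) (simp add: frechet_derivative_works[symmetric])
qed

lemma borel_measurable_partials:
  assumes "\<And>z. u differentiable (at z)"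
  shows "partial_x u \<in> borel_measurable borel" "partial_y u \<in> borel_measurable borel"
    "grad_sq u \<in> borel_measurable borel"
    "(\<lambda>z. u z \<bullet> cross3 (partial_y u z) (partial_x u z)) \<in> borel_measurable borel"
proof -
  show x [measurable]: "partial_x u \<in> borel_measurable borel" and y [measurable]: "partial_y u \<in> borel_measurable borel"
    unfolding partial_x_def[abs_def] partial_y_def[abs_def]
    using borel_measurable_frechet_derivative[OF assms] by blast+
  show "grad_sq u \<in> borel_measurable borel"
    unfolding grad_sq_def[abs_def] by measurable
  have c: "continuous_on UNIV u"
    using assms by (meson continuous_at_imp_continuous_on differentiable_imp_continuous_within)
  then have u [measurable]: "u \<in> borel_measurable borel" by (rule borel_measurable_continuous_onI)
  have nth: "f \<in> borel_measurable borel \<Longrightarrow> (\<lambda>z::complex. (f z :: real^3) $ i) \<in> borel_measurable borel" for f i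
    by (rule measurable_compose[of f _ borel]) (auto intro!: borel_measurable_continuous_onI continuous_intros)
  note [measurable] = nth[OF x] nth[OF y] nth[OF u]
  show "(\<lambda>z. u z \<bullet> cross3 (partial_y u z) (partial_x u z)) \<in> borel_measurable borel"
    unfolding inner_vec_def sum_3 by (simp add: cross3_def) measurable
qed

text \<open>The Bochner integral of a non-integrable function is 0 by convention, so a positive
  lower bound for the distance integral requires integrability first.\<close>

lemma integrable_grad_sq_diff:
  assumes u: "\<And>z. u differentiable (at z)" "integrable lborel (grad_sq u)"
    and v: "\<And>z. v differentiable (at z)" "integrable lborel (grad_sq v)"
  shows "integrable lborel (grad_sq (\<lambda>z. u z - v z))"
proof (rule Bochner_Integration.integrable_bound)
  show "integrable lborel (\<lambda>z. 2 * grad_sq u z + 2 * grad_sq v z)"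
    using u v by (intro Bochner_Integration.integrable_add integrable_mult_right) auto
  have "(\<lambda>z. u z - v z) differentiable at z" for z using u v by auto
  then show "grad_sq (\<lambda>z. u z - v z) \<in> borel_measurable lborel"
    using borel_measurable_partials(3)[of "\<lambda>z. u z - v z"] by simp
  have n: "(norm (x - y))\<^sup>2 \<le> 2 * (norm x)\<^sup>2 + 2 * (norm y)\<^sup>2" for x y :: "real^3"
  proof -
    have "(norm (x - y))\<^sup>2 \<le> (norm x + norm y)\<^sup>2" by (intro power_mono norm_triangle_ineq4) auto
    also have "\<dots> \<le> 2 * (norm x)\<^sup>2 + 2 * (norm y)\<^sup>2"
      using sum_squares_bound[of "norm x" "norm y"] by (simp add: power2_sum)
    finally show ?thesis .
  qed
  have "grad_sq (\<lambda>z. u z - v z) z \<le> 2 * grad_sq u z + 2 * grad_sq v z" for z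
  proof -
    have D: "((\<lambda>z. u z - v z) has_derivative (\<lambda>h. frechet_derivative u (at z) h - frechet_derivative v (at z) h)) (at z)"
      using u v by (intro has_derivative_diff) (auto simp: frechet_derivative_works[symmetric])
    show ?thesis
      unfolding grad_sq_def has_derivative_imp_partials[OF D] unfolding partial_x_def partial_y_def
      using n[of "frechet_derivative u (at z) 1" "frechet_derivative v (at z) 1"] 
        n[of "frechet_derivative u (at z) \<i>" "frechet_derivative v (at z) \<i>"] by argo
  qed
  then show "AE z in lborel. norm (grad_sq (\<lambda>z. u z - v z) z) \<le> norm (2 * grad_sq u z + 2 * grad_sq v z)"
    by (intro AE_I2) (simp add: grad_sq_def)
qed

section \<open>Integrals over the plane\<close>

text \<open>The disc of radius sqrt b has area \<pi> b, so in the variable t = |z|^2 the planar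
  measure has constant density \<pi> on the half line. Agreement on the half lines
  \<open>{..b}\<close>, which are stable under intersection and generate the Borel sets,
  suffices.\<close>

lemma distr_cmod_sq:
  "distr lborel borel (\<lambda>z. (cmod z)\<^sup>2) = density lborel (\<lambda>t. ennreal pi * indicator {0..} t)"
    (is "?M = ?N")
proof (rule measure_eqI_generator_eq[where E = "range atMost" and \<Omega> = UNIV and A = "\<lambda>i. {..real i}"])
  have M: "emeasure ?M {..b} = ennreal (pi * max b 0)" for b
  proof (cases "b < 0")
    case True
    have "(\<lambda>z. (cmod z)\<^sup>2) -` {..b} = {}" 
    proof -
      have "\<not> (cmod z)\<^sup>2 \<le> b" for z using True zero_le_power2[of "cmod z"] by linarith
      then show ?thesis by auto
    qed
    then show ?thesis using True by (subst emeasure_distr) (auto simp del: zero_le_power2)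
  next
    case False
    have "(cmod z)\<^sup>2 \<le> b \<longleftrightarrow> cmod z \<le> sqrt b" for z
      using real_sqrt_le_iff[of "(cmod z)\<^sup>2" b] unfolding real_sqrt_abs by simp
    then have "(\<lambda>z. (cmod z)\<^sup>2) -` {..b} = cball 0 (sqrt b)" by auto
    then show ?thesis using False by (subst emeasure_distr) (auto simp: emeasure_cball unit_ball_vol_2)
  qed
  have N: "emeasure ?N {..b} = ennreal (pi * max b 0)" for b
  proof -
    have "emeasure ?N {..b} = (\<integral>\<^sup>+t. ennreal pi * indicator {0..b} t \<partial>lborel)"
      by (subst emeasure_density) (auto intro!: nn_integral_cong simp: indicator_def)
    also have "\<dots> = ennreal pi * emeasure lborel {0..b}"
      by (subst nn_integral_cmult_indicator) auto
    also have "\<dots> = ennreal (pi * max b 0)"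
      by (cases "0 \<le> b") (auto simp: ennreal_mult)
    finally show ?thesis .
  qed
  show "Int_stable (range atMost :: real set set)"
    unfolding Int_stable_def by (auto simp: Int_atMost)
  show "emeasure ?M X = emeasure ?N X" if "X \<in> range atMost" for X
    using that M N by auto
  show "sets ?M = sigma_sets UNIV (range atMost)" "sets ?N = sigma_sets UNIV (range atMost)"
    by (simp_all add: borel_eq_atMost)
  show "(\<Union>i. {..real i}) = UNIV" using real_arch_simple by auto
  show "emeasure ?M {..real i} \<noteq> \<infinity>" for i unfolding M by simp
  show "range (\<lambda>i. {..real i}) \<subseteq> range atMost" by blast
qed simp_all

lemma nn_integral_radial:
  assumes [measurable]: "F \<in> borel_measurable borel"
  shows "(\<integral>\<^sup>+z. F ((cmod z)\<^sup>2) \<partial>lborel) = ennreal pi * (\<integral>\<^sup>+t. F t * indicator {0..} t \<partial>lborel)"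
proof -
  have "(\<integral>\<^sup>+z. F ((cmod z)\<^sup>2) \<partial>lborel) = (\<integral>\<^sup>+t. F t \<partial>distr lborel borel (\<lambda>z. (cmod z)\<^sup>2))"
    by (subst nn_integral_distr) auto
  also have "\<dots> = (\<integral>\<^sup>+t. ennreal pi * (F t * indicator {0..} t) \<partial>lborel)"
    unfolding distr_cmod_sq by (subst nn_integral_density) (auto intro!: nn_integral_cong simp: mult_ac)
  finally show ?thesis by (simp add: nn_integral_cmult)
qed

text \<open>For a nonnegative integrand the computation can be made with the extended nonnegative
  integral, which yields integrability and the value together.\<close>

lemma has_bochner_integral_radial_FTC:
  fixes f F :: "real \<Rightarrow> real"
  assumes [measurable]: "f \<in> borel_measurable borel"
    and F: "\<And>t. t \<ge> 0 \<Longrightarrow> (F has_real_derivative f t) (at t)"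
    and f: "\<And>t. t \<ge> 0 \<Longrightarrow> f t \<ge> 0" and T: "(F \<longlongrightarrow> T) at_top"
  shows "has_bochner_integral lborel (\<lambda>z::complex. f ((cmod z)\<^sup>2)) (pi * (T - F 0))"
proof (rule has_bochner_integral_nn_integral)
  have "(\<integral>\<^sup>+z. ennreal (f ((cmod z)\<^sup>2)) \<partial>lborel) = ennreal pi * (\<integral>\<^sup>+t. ennreal (f t) * indicator {0..} t \<partial>lborel)"
    by (rule nn_integral_radial) auto
  also have "(\<integral>\<^sup>+t. ennreal (f t) * indicator {0..} t \<partial>lborel) = ennreal (T - F 0)"
    by (rule nn_integral_FTC_atLeast) (use F f T in auto)
  finally show "(\<integral>\<^sup>+z. ennreal (f ((cmod z)\<^sup>2)) \<partial>lborel) = ennreal (pi * (T - F 0))"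
    by (simp add: ennreal_mult')
  have "F 0 \<le> T"
  proof (rule tendsto_lowerbound[OF T])
    show "\<forall>\<^sub>F x in at_top. F 0 \<le> F x"
      using eventually_ge_at_top[of 0]
    proof eventually_elim
      case (elim x)
      show ?case by (rule DERIV_nonneg_imp_nondecreasing[OF elim]) (use F f in blast)
    qed
  qed auto
  then show "0 \<le> pi * (T - F 0)" by simp
  show "AE z in lborel. 0 \<le> f ((cmod z)\<^sup>2)" using f by auto
qed simp

text \<open>The logarithmic integral that bounds the energy excess, used with
  \<open>b = exp (4 * l)\<close>; over the whole plane it would diverge when
  \<open>c > 0\<close>.\<close>

lemma has_bochner_integral_radial_inverse:
  assumes "b \<ge> 0" "c \<ge> 0"
  shows "has_bochner_integral lborel (\<lambda>z::complex. c / (1 + (cmod z)\<^sup>2) * indicator {0..b} ((cmod z)\<^sup>2)) (pi * c * ln (1 + b))"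
proof (rule has_bochner_integral_nn_integral)
  have "(\<integral>\<^sup>+z. ennreal (c / (1 + (cmod z)\<^sup>2) * indicator {0..b} ((cmod z)\<^sup>2)) \<partial>lborel)
     = ennreal pi * (\<integral>\<^sup>+t. ennreal (c / (1 + t) * indicator {0..b} t) * indicator {0..} t \<partial>lborel)"
    by (rule nn_integral_radial) auto
  also have "(\<integral>\<^sup>+t. ennreal (c / (1 + t) * indicator {0..b} t) * indicator {0..} t \<partial>lborel)
     = (\<integral>\<^sup>+t. ennreal (c / (1 + t)) * indicator {0..b} t \<partial>lborel)"
    by (intro nn_integral_cong) (auto simp: indicator_def)
  also have "\<dots> = ennreal (c * ln (1 + b) - c * ln (1 + 0))"
    by (rule nn_integral_FTC_Icc) (use assms in \<open>auto intro!: derivative_eq_intros\<close>)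
  finally show "(\<integral>\<^sup>+z. ennreal (c / (1 + (cmod z)\<^sup>2) * indicator {0..b} ((cmod z)\<^sup>2)) \<partial>lborel)
      = ennreal (pi * c * ln (1 + b))"
    by (simp add: ennreal_mult' mult.assoc)
qed (use assms in auto)

text \<open>A quarter turn maps boxes to boxes and swaps their side lengths, so checking boxes is
  enough.\<close>

lemma lborel_mult_ii: "distr lborel borel ((*) \<i>) = (lborel :: complex measure)"
proof (rule lborel_eqI[symmetric])
  fix l u :: complex
  assume le: "\<And>b. b \<in> Basis \<Longrightarrow> l \<bullet> b \<le> u \<bullet> b"
  have le': "Re l \<le> Re u" "Im l \<le> Im u"
    using le[of 1] le[of \<i>] by (auto simp: Basis_complex_def)
  have "(*) \<i> -` box l u = box (Complex (Im l) (- Re u)) (Complex (Im u) (- Re l))"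
    by (auto simp: box_def Basis_complex_def)
  then have "emeasure (distr lborel borel ((*) \<i>)) (box l u) = emeasure lborel (box (Complex (Im l) (- Re u)) (Complex (Im u) (- Re l)))"
    by (subst emeasure_distr) auto
  also have "\<dots> = ennreal (\<Prod>b\<in>Basis. (u - l) \<bullet> b)"
    using le' by (subst emeasure_lborel_box) (auto simp: Basis_complex_def mult.commute)
  finally show "emeasure (distr lborel borel ((*) \<i>)) (box l u) = ennreal (\<Prod>b\<in>Basis. (u - l) \<bullet> b)" .
qed simp

text \<open>Averaging over the rotations by powers of \<open>\<i>\<close> replaces integration in polar coordinates.\<close>

lemma integral_annulus_ge:
  fixes g :: "complex \<Rightarrow> real"
  assumes g: "integrable lborel g" and pos: "\<And>z. g z \<ge> 0" and r: "r > 0"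
    and c: "\<And>z. r / 2 < cmod z \<Longrightarrow> cmod z < r \<Longrightarrow> g z + g (\<i> * z) + g (- z) + g (- (\<i> * z)) \<ge> c"
  shows "(\<integral>z. g z \<partial>lborel) \<ge> 3 * pi / 16 * r\<^sup>2 * c"
proof -
  have rot: "integrable lborel (\<lambda>z. f (\<i> * z)) \<and> (\<integral>z. f (\<i> * z) \<partial>lborel) = (\<integral>z. f z \<partial>lborel)" 
    if "integrable lborel f" for f :: "complex \<Rightarrow> real"
  proof -
    have [measurable]: "f \<in> borel_measurable borel" using that by auto
    show ?thesis using that
      integrable_distr_eq[of "(*) \<i>" lborel borel f] integral_distr[of "(*) \<i>" lborel borel f]
      unfolding lborel_mult_ii by simp
  qed
  note r1 = rot[OF g]
  note r2 = rot[OF r1[THEN conjunct1]]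
  note r3 = rot[OF r2[THEN conjunct1]]
  have e: "\<i> * (\<i> * z) = - z" "\<i> * (- z) = - (\<i> * z)" for z by (auto simp: complex_eq_iff)
  \<comment> \<open>The annulus has area (3/4)\<pi> r^2; dividing by the four rotations gives the
    constant 3\<pi>/16.\<close>
  define D where "D = ball (0::complex) r - cball 0 (r / 2)"
  have mD: "measure lborel D = 3 * pi / 4 * r\<^sup>2"
    unfolding D_def using r
    by (subst measure_Diff) (auto simp: content_ball content_cball unit_ball_vol_2 power_divide emeasure_ball)
  have "emeasure lborel D < \<infinity>" 
    by (rule le_less_trans[OF emeasure_mono[of _ "ball 0 r"]]) (auto simp: D_def emeasure_ball r less_imp_le)
  then have iD: "integrable lborel (\<lambda>z. c * indicator D z)"
    by (intro integrable_mult_right integrable_real_indicator) (auto simp: D_def)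
  have "3 * pi / 4 * r\<^sup>2 * c = (\<integral>z. c * indicator D z \<partial>lborel)"
    using mD by simp
  also have "\<dots> \<le> (\<integral>z. g z + g (\<i> * z) + g (- z) + g (- (\<i> * z)) \<partial>lborel)"
  proof (rule integral_mono[OF iD])
    show "integrable lborel (\<lambda>z. g z + g (\<i> * z) + g (- z) + g (- (\<i> * z)))"
      using g r1 r2 r3 unfolding e by auto
    show "c * indicator D z \<le> g z + g (\<i> * z) + g (- z) + g (- (\<i> * z))" for z
      using c[of z] pos[of z] pos[of "\<i> * z"] pos[of "- z"] pos[of "- (\<i> * z)"] by (auto simp: D_def indicator_def)
  qed
  also have "\<dots> = 4 * (\<integral>z. g z \<partial>lborel)"
    using g r1 r2 r3 unfolding e by simp
  finally show ?thesis by simp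
qed

section \<open>Rational maps of degree 2\<close>

lemma poly_degree_le_2:
  fixes p :: "'a::comm_semiring_1 poly"
  assumes "degree p \<le> 2"
  shows "poly p z = coeff p 0 + coeff p 1 * z + coeff p 2 * z\<^sup>2"
proof -
  have "poly p z = (\<Sum>i\<le>2. coeff p i * z ^ i)"
    unfolding poly_altdef by (rule sum.mono_neutral_left) (use assms in \<open>auto simp: coeff_eq_0\<close>)
  then show ?thesis by (simp add: numeral_2_eq_2)
qed

lemma coprime_imp_no_common_root:
  fixes p q :: "complex poly"
  assumes "coprime p q"
  shows "poly p z \<noteq> 0 \<or> poly q z \<noteq> 0"
proof (rule ccontr)
  assume "\<not> ?thesis"
  then have "[:- z, 1:] dvd p" "[:- z, 1:] dvd q" by (auto simp: poly_eq_0_iff_dvd)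
  then have "[:- z, 1:] dvd 1" using assms coprime_common_divisor by blast
  then show False using is_unit_iff_degree[of "[:- z, 1:]"] by simp
qed

lemma stereo_rat_eq_hopf:
  assumes "poly p z \<noteq> 0 \<or> poly q z \<noteq> 0"
  shows "stereo_rat p q z = hopf (poly p z) (poly q z)"
proof (cases "poly q z = 0")
  case True
  then show ?thesis using assms
    by (simp add: stereo_rat_def north_pole_def hopf_def triple_def)
next
  case False
  define a where "a = poly p z"
  define b where "b = poly q z"
  have b: "b \<noteq> 0" "cmod b > 0" using False b_def by auto
  have sq: "(cmod (a / b))\<^sup>2 = (cmod a)\<^sup>2 / (cmod b)\<^sup>2" by (simp add: norm_divide power_divide)
  have one: "1 + (cmod (a / b))\<^sup>2 = ((cmod a)\<^sup>2 + (cmod b)\<^sup>2) / (cmod b)\<^sup>2"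
    "(cmod (a / b))\<^sup>2 - 1 = ((cmod a)\<^sup>2 - (cmod b)\<^sup>2) / (cmod b)\<^sup>2"
    unfolding sq using b by (simp_all add: field_simps)
  have q: "a / b = a * cnj b / of_real ((cmod b)\<^sup>2)" by (rule complex_div_cnj)
  have "stereo (a / b) = triple (2 * a * cnj b / of_real ((cmod a)\<^sup>2 + (cmod b)\<^sup>2))
                     (((cmod a)\<^sup>2 - (cmod b)\<^sup>2) / ((cmod a)\<^sup>2 + (cmod b)\<^sup>2))"
    unfolding stereo_def triple_def one
  proof -
    have "Re (a / b) = Re (a * cnj b) / (cmod b)\<^sup>2" "Im (a / b) = Im (a * cnj b) / (cmod b)\<^sup>2"
      unfolding q by (simp_all add: Re_divide_of_real Im_divide_of_real del: of_real_power)
    moreover have "Re (2 * a * cnj b / of_real ((cmod a)\<^sup>2 + (cmod b)\<^sup>2)) = 2 * Re (a * cnj b) / ((cmod a)\<^sup>2 + (cmod b)\<^sup>2)"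
      "Im (2 * a * cnj b / of_real ((cmod a)\<^sup>2 + (cmod b)\<^sup>2)) = 2 * Im (a * cnj b) / ((cmod a)\<^sup>2 + (cmod b)\<^sup>2)"
      unfolding Re_divide_of_real Im_divide_of_real by simp_all
    ultimately show "vector [2 * Re (a / b) / (((cmod a)\<^sup>2 + (cmod b)\<^sup>2) / (cmod b)\<^sup>2),
       2 * Im (a / b) / (((cmod a)\<^sup>2 + (cmod b)\<^sup>2) / (cmod b)\<^sup>2),
       ((cmod a)\<^sup>2 - (cmod b)\<^sup>2) / (cmod b)\<^sup>2 / (((cmod a)\<^sup>2 + (cmod b)\<^sup>2) / (cmod b)\<^sup>2)] =
      (vector [Re (2 * a * cnj b / of_real ((cmod a)\<^sup>2 + (cmod b)\<^sup>2)), Im (2 * a * cnj b / of_real ((cmod a)\<^sup>2 + (cmod b)\<^sup>2)),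
        ((cmod a)\<^sup>2 - (cmod b)\<^sup>2) / ((cmod a)\<^sup>2 + (cmod b)\<^sup>2)] :: real^3)"
      using b by (simp add: mult.assoc)
  qed
  then show ?thesis using False by (simp add: stereo_rat_def hopf_def a_def b_def)
qed

text \<open>Compactness of the closed unit disc. The statement is about coefficients so that it also
  applies to the reversed polynomials in 1/z.\<close>

lemma quadratic_pair_ge:
  fixes a0 a1 a2 b0 b1 b2 :: complex
  assumes "\<And>z. a0 + a1 * z + a2 * z\<^sup>2 \<noteq> 0 \<or> b0 + b1 * z + b2 * z\<^sup>2 \<noteq> 0"
  obtains c where "c > 0"
    "\<And>z. cmod z \<le> 1 \<Longrightarrow> (cmod (a0 + a1 * z + a2 * z\<^sup>2))\<^sup>2 + (cmod (b0 + b1 * z + b2 * z\<^sup>2))\<^sup>2 \<ge> c"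
proof -
  let ?N = "\<lambda>z. (cmod (a0 + a1 * z + a2 * z\<^sup>2))\<^sup>2 + (cmod (b0 + b1 * z + b2 * z\<^sup>2))\<^sup>2"
  have "\<exists>x\<in>cball 0 1. \<forall>y\<in>cball 0 1. ?N x \<le> ?N y"
    by (rule continuous_attains_inf) (auto intro!: continuous_intros)
  then obtain x where x: "\<forall>y\<in>cball 0 1. ?N x \<le> ?N y" by blast
  then have "?N x \<le> ?N y" if "cmod y \<le> 1" for y using that by simp
  moreover have "?N x > 0" using assms by (rule sum_cmod_sq_pos)
  ultimately show ?thesis using that by blast
qed

text \<open>The pair has no common zero on the Riemann sphere; \<open>top\<close> excludes one at
  infinity. Inside the unit disc compactness applies directly, outside it applies to the reversed
  pair at 1/z.\<close>

lemma quadratic_pair_growth: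
  fixes a0 a1 a2 b0 b1 b2 :: complex
  assumes nz: "\<And>z. a0 + a1 * z + a2 * z\<^sup>2 \<noteq> 0 \<or> b0 + b1 * z + b2 * z\<^sup>2 \<noteq> 0"
    and top: "a2 \<noteq> 0 \<or> b2 \<noteq> 0"
  obtains c where "c > 0"
    "\<And>z. (cmod (a0 + a1 * z + a2 * z\<^sup>2))\<^sup>2 + (cmod (b0 + b1 * z + b2 * z\<^sup>2))\<^sup>2 \<ge> c * (1 + (cmod z)\<^sup>2)\<^sup>2"
proof -
  let ?N = "\<lambda>z. (cmod (a0 + a1 * z + a2 * z\<^sup>2))\<^sup>2 + (cmod (b0 + b1 * z + b2 * z\<^sup>2))\<^sup>2"
  obtain c1 where c1: "c1 > 0" "\<And>z. cmod z \<le> 1 \<Longrightarrow> ?N z \<ge> c1"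
    using quadratic_pair_ge[OF nz] by metis
  have rev: "x + y * w + z * w\<^sup>2 = w\<^sup>2 * (z + y * (1 / w) + x * (1 / w)\<^sup>2)" if "w \<noteq> 0" for x y z w :: complex
    using that by (simp add: field_simps power2_eq_square)
  have nz': "a2 + a1 * w + a0 * w\<^sup>2 \<noteq> 0 \<or> b2 + b1 * w + b0 * w\<^sup>2 \<noteq> 0" for w
  proof (cases "w = 0")
    case True
    then show ?thesis using top by simp
  next
    case False
    then show ?thesis using nz[of "1 / w"] rev[OF False, of a2 a1 a0] rev[OF False, of b2 b1 b0] by simp
  qed
  obtain c2 where c2: "c2 > 0" "\<And>z. cmod z \<le> 1 \<Longrightarrow> (cmod (a2 + a1 * z + a0 * z\<^sup>2))\<^sup>2 + (cmod (b2 + b1 * z + b0 * z\<^sup>2))\<^sup>2 \<ge> c2"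
    using quadratic_pair_ge[OF nz'] by metis
  \<comment> \<open>(1 + |z|^2)^2 is at most 4 in the unit disc and at most 4|z|^4 outside
    it.\<close>
  define c where "c = min c1 c2 / 4"
  have "?N z \<ge> c * (1 + (cmod z)\<^sup>2)\<^sup>2" for z
  proof (cases "cmod z \<le> 1")
    case True
    have "(1 + (cmod z)\<^sup>2)\<^sup>2 \<le> (1 + 1\<^sup>2)\<^sup>2" using True by (intro power_mono add_left_mono) auto
    then have "c * (1 + (cmod z)\<^sup>2)\<^sup>2 \<le> c * 4" using c1 c2 unfolding c_def by (intro mult_left_mono) auto
    also have "\<dots> \<le> c1" by (simp add: c_def)
    finally show ?thesis using c1(2)[OF True] by linarith
  next
    case False
    then have z: "z \<noteq> 0" and w: "cmod (1 / z) \<le> 1" by (auto simp: norm_divide divide_le_eq_1)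
    have z2: "1 \<le> (cmod z)\<^sup>2" using False by simp
    have "(1 + (cmod z)\<^sup>2)\<^sup>2 \<le> (2 * (cmod z)\<^sup>2)\<^sup>2" using z2 by (intro power_mono) auto
    then have "c * (1 + (cmod z)\<^sup>2)\<^sup>2 \<le> c * (2 * (cmod z)\<^sup>2)\<^sup>2" using c1 c2 unfolding c_def by (intro mult_left_mono) auto
    also have "\<dots> = (c * 4) * (cmod z) ^ 4" by (simp add: power_mult_distrib)
    also have "\<dots> \<le> c2 * (cmod z) ^ 4" by (intro mult_right_mono) (auto simp: c_def)
    also have "\<dots> \<le> ((cmod (a2 + a1 * (1 / z) + a0 * (1 / z)\<^sup>2))\<^sup>2 + (cmod (b2 + b1 * (1 / z) + b0 * (1 / z)\<^sup>2))\<^sup>2) * (cmod z) ^ 4"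
      using c2(2)[OF w] by (intro mult_right_mono) auto
    also have "\<dots> = ?N z"
      unfolding rev[OF z, of a0 a1 a2] rev[OF z, of b0 b1 b2] norm_mult power_mult_distrib norm_power
      by (simp add: algebra_simps)
    finally show ?thesis .
  qed
  moreover have "c > 0" using c1 c2 by (simp add: c_def)
  ultimately show ?thesis using that by blast
qed

lemma A2_D:
  assumes "(p, q) \<in> A2"
  shows "degree p \<le> 2" "degree q \<le> 2" "coeff p 2 \<noteq> 0 \<or> coeff q 2 \<noteq> 0"
    "poly p z \<noteq> 0 \<or> poly q z \<noteq> 0"
    "stereo_rat p q = (\<lambda>z. hopf (poly p z) (poly q z))"
proof -
  have c: "coprime p q" and m: "max (degree p) (degree q) = 2" using assms by (auto simp: A2_def)
  show "degree p \<le> 2" "degree q \<le> 2" using m by auto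
  have "degree p = 2 \<or> degree q = 2" using m by linarith
  then show "coeff p 2 \<noteq> 0 \<or> coeff q 2 \<noteq> 0"
    by (metis coeff_0 degree_0 leading_coeff_0_iff zero_neq_numeral)
  show nz: "poly p z \<noteq> 0 \<or> poly q z \<noteq> 0" for z using coprime_imp_no_common_root[OF c] .
  show "stereo_rat p q = (\<lambda>z. hopf (poly p z) (poly q z))" using stereo_rat_eq_hopf[OF nz] by auto
qed

lemma stereo_rat_differentiable:
  assumes "(p, q) \<in> A2"
  shows "stereo_rat p q differentiable (at z)"
  unfolding A2_D(5)[OF assms] differentiable_def
  using has_derivative_hopf[OF poly_DERIV[unfolded has_field_derivative_def] poly_DERIV[unfolded has_field_derivative_def] A2_D(4)[OF assms]]
  by blast

text \<open>The cubic terms of the Wronskian q p' - p q' cancel, so it grows at most like 1 + |z|^2,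
  while |p|^2 + |q|^2 grows like its square. The energy density is therefore at most a multiple of
  1/(1 + |z|^2)^2.\<close>

lemma integrable_grad_sq_stereo_rat:
  assumes "(p, q) \<in> A2"
  shows "integrable lborel (grad_sq (stereo_rat p q))"
proof -
  note A = A2_D[OF assms]
  define a b where "a = coeff p" and "b = coeff q"
  have p: "poly p z = a 0 + a 1 * z + a 2 * z\<^sup>2" and q: "poly q z = b 0 + b 1 * z + b 2 * z\<^sup>2" for z
    using A poly_degree_le_2 unfolding a_def b_def by auto
  have nz: "a 0 + a 1 * z + a 2 * z\<^sup>2 \<noteq> 0 \<or> b 0 + b 1 * z + b 2 * z\<^sup>2 \<noteq> 0" for z
    using A(4)[of z] unfolding p q .
  have top: "a 2 \<noteq> 0 \<or> b 2 \<noteq> 0" using A(3) unfolding a_def b_def .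
  obtain c where c: "c > 0" "\<And>z. (cmod (poly p z))\<^sup>2 + (cmod (poly q z))\<^sup>2 \<ge> c * (1 + (cmod z)\<^sup>2)\<^sup>2"
    using quadratic_pair_growth[OF nz top] unfolding p q by metis
  define W where "W = (\<lambda>z. poly q z * (a 1 + 2 * a 2 * z) - poly p z * (b 1 + 2 * b 2 * z))"
  define k0 k1 k2 where "k0 = a 1 * b 0 - a 0 * b 1" and "k1 = 2 * (a 2 * b 0 - a 0 * b 2)" and "k2 = a 2 * b 1 - a 1 * b 2"
  have W: "W z = k0 + k1 * z + k2 * z\<^sup>2" for z
    unfolding W_def p q k0_def k1_def k2_def by algebra
  define K where "K = cmod k0 + cmod k1 + cmod k2"
  have Wle: "cmod (W z) \<le> K * (1 + (cmod z)\<^sup>2)" for z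
  proof -
    have r: "cmod z \<le> 1 + (cmod z)\<^sup>2" using sum_squares_bound[of "cmod z" 1] by (simp add: power2_eq_square) (smt (verit) norm_ge_zero)
    have "cmod (W z) \<le> cmod k0 + cmod k1 * cmod z + cmod k2 * (cmod z)\<^sup>2"
      unfolding W by (metis (no_types, lifting) add_right_mono norm_mult norm_power norm_triangle_ineq norm_triangle_le)
    also have "\<dots> \<le> cmod k0 * (1 + (cmod z)\<^sup>2) + cmod k1 * (1 + (cmod z)\<^sup>2) + cmod k2 * (1 + (cmod z)\<^sup>2)"
      using r by (intro add_mono mult_left_mono) (auto simp: mult_le_cancel_left1)
    also have "\<dots> = K * (1 + (cmod z)\<^sup>2)" by (simp add: K_def algebra_simps)
    finally show ?thesis .
  qed
  have dp: "(poly p has_derivative (\<lambda>h. (a 1 + 2 * a 2 * z) * h)) (at z)"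
    and dq: "(poly q has_derivative (\<lambda>h. (b 1 + 2 * b 2 * z) * h)) (at z)" for z
    unfolding p[abs_def] q[abs_def] by (auto intro!: derivative_eq_intros simp: fun_eq_iff algebra_simps)
  have G: "grad_sq (stereo_rat p q) z = 8 * (cmod (W z))\<^sup>2 / ((cmod (poly p z))\<^sup>2 + (cmod (poly q z))\<^sup>2)\<^sup>2" for z
    unfolding A(5) by (subst grad_sq_hopf(1)[OF dp dq A(4), where \<alpha> = "W z" and \<beta> = 0])
      (auto simp: W_def algebra_simps)
  define C where "C = 8 * K\<^sup>2 / c\<^sup>2"
  have Gle: "grad_sq (stereo_rat p q) z \<le> C / (1 + (cmod z)\<^sup>2)\<^sup>2" for z
  proof -
    define s where "s = 1 + (cmod z)\<^sup>2"
    have s: "s > 0" unfolding s_def by (simp add: add_pos_nonneg)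
    have "grad_sq (stereo_rat p q) z \<le> 8 * (K * s)\<^sup>2 / (c * s\<^sup>2)\<^sup>2"
      unfolding G using Wle[of z] c(2)[of z] c(1) s unfolding s_def[symmetric]
      by (intro frac_le mult_left_mono power_mono) auto
    also have "\<dots> = C / s\<^sup>2" unfolding C_def using s by (simp add: power2_eq_square)
    finally show ?thesis unfolding s_def .
  qed
  have "C \<ge> 0" unfolding C_def by simp
  have "has_bochner_integral lborel (\<lambda>z::complex. C / (1 + (cmod z)\<^sup>2)\<^sup>2) (pi * (0 - (- C / (1 + 0))))"
  proof (rule has_bochner_integral_radial_FTC)
    show "((\<lambda>t. - C / (1 + t)) has_real_derivative C / (1 + t)\<^sup>2) (at t)" if "t \<ge> 0" for t
      using that by (auto intro!: derivative_eq_intros simp: power2_eq_square)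
    have "((\<lambda>t::real. - C * inverse (1 + t)) \<longlongrightarrow> - C * 0) at_top"
      by (intro tendsto_intros tendsto_inverse_0_at_top filterlim_tendsto_add_at_top[OF tendsto_const] filterlim_ident)
    then show "((\<lambda>t. - C / (1 + t)) \<longlongrightarrow> 0) at_top" by (simp add: divide_inverse)
  qed (use \<open>C \<ge> 0\<close> in auto)
  then have "integrable lborel (\<lambda>z::complex. C / (1 + (cmod z)\<^sup>2)\<^sup>2)" by (simp add: has_bochner_integral_iff)
  then show ?thesis
  proof (rule Bochner_Integration.integrable_bound)
    show "grad_sq (stereo_rat p q) \<in> borel_measurable lborel"
      using borel_measurable_partials(3)[OF stereo_rat_differentiable[OF assms]] by simp
    show "AE z in lborel. norm (grad_sq (stereo_rat p q) z) \<le> norm (C / (1 + (cmod z)\<^sup>2)\<^sup>2)"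
      using Gle \<open>C \<ge> 0\<close> by (intro AE_I2) (simp add: grad_sq_def)
  qed
qed

section \<open>Defect of \<open>p / q\<close> from a linear map, at one scale and at two\<close>

lemma parseval_4:
  fixes c0 c1 c2 c3 z :: complex
  defines "r \<equiv> \<lambda>z. c0 + c1 * z + c2 * z\<^sup>2 + c3 * z^3"
  shows "(cmod (r z))\<^sup>2 + (cmod (r (\<i> * z)))\<^sup>2 + (cmod (r (- z)))\<^sup>2 + (cmod (r (- (\<i> * z))))\<^sup>2
    = 4 * ((cmod c0)\<^sup>2 + (cmod c1 * cmod z)\<^sup>2 + (cmod c2 * (cmod z)\<^sup>2)\<^sup>2 + (cmod c3 * cmod z ^ 3)\<^sup>2)"
proof -
  define d1 d2 d3 where "d1 = c1 * z" and "d2 = c2 * z\<^sup>2" and "d3 = c3 * z^3"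
  have e: "cmod c1 * cmod z = cmod d1" "cmod c2 * (cmod z)\<^sup>2 = cmod d2" "cmod c3 * cmod z ^ 3 = cmod d3"
    unfolding d1_def d2_def d3_def by (simp_all add: norm_mult norm_power)
  have "r z = c0 + d1 + d2 + d3" "r (\<i> * z) = c0 + \<i> * d1 - d2 - \<i> * d3"
    "r (- z) = c0 - d1 + d2 - d3" "r (- (\<i> * z)) = c0 - \<i> * d1 - d2 + \<i> * d3"
    unfolding r_def d1_def d2_def d3_def
    by (simp_all add: power2_eq_square power3_eq_cube algebra_simps complex_eq_iff)
  \<comment> \<open>Discrete Parseval identity for the fourth roots of unity: four rotations
    separate the four coefficients of a cubic.\<close>
  moreover have "(cmod (a + b + c + d))\<^sup>2 + (cmod (a + \<i> * b - c - \<i> * d))\<^sup>2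
      + (cmod (a - b + c - d))\<^sup>2 + (cmod (a - \<i> * b - c + \<i> * d))\<^sup>2
      = 4 * ((cmod a)\<^sup>2 + (cmod b)\<^sup>2 + (cmod c)\<^sup>2 + (cmod d)\<^sup>2)" for a b c d
    unfolding cmod_power2 by (simp add: power2_eq_square algebra_simps)
  ultimately show ?thesis unfolding e by (simp only:)
qed

text \<open>Squared norm of the coefficients (up to unimodular factors) of the cubic
  \<open>\<zeta> q(l \<zeta>) - s p(l \<zeta>)\<close> when \<open>\<bar>s\<bar> = 1\<close>; it vanishes exactly when \<open>p/q\<close> is \<open>z/(s l)\<close>.\<close>

definition scaled_defect :: "real \<Rightarrow> complex \<Rightarrow> complex poly \<Rightarrow> complex poly \<Rightarrow> real" where
  "scaled_defect l s p q = (cmod (coeff p 0))\<^sup>2 + (cmod (coeff q 0 - s * of_real l * coeff p 1))\<^sup>2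
     + (cmod (of_real l * coeff q 1 - s * (of_real l)\<^sup>2 * coeff p 2))\<^sup>2 + (cmod ((of_real l)\<^sup>2 * coeff q 2))\<^sup>2"

text \<open>Squared norm of the coefficients of p(l \<zeta>) and q(l \<zeta>). Like the defect it is
  homogeneous of degree 2 in (p, q), so the ratio of the two depends only on p/q.\<close>

definition scaled_size :: "real \<Rightarrow> complex poly \<Rightarrow> complex poly \<Rightarrow> real" where
  "scaled_size l p q = (cmod (coeff p 0))\<^sup>2 + (cmod (coeff q 0))\<^sup>2 + (l * cmod (coeff p 1))\<^sup>2 + (l * cmod (coeff q 1))\<^sup>2
     + (l\<^sup>2 * cmod (coeff p 2))\<^sup>2 + (l\<^sup>2 * cmod (coeff q 2))\<^sup>2"

lemma quadratic_le_scaled_size: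
  assumes "(p, q) \<in> A2" "l > 0" "cmod z \<le> l"
  shows "(cmod (poly p z))\<^sup>2 + (cmod (poly q z))\<^sup>2 \<le> 3 * scaled_size l p q"
proof -
  have *: "(cmod (x + y * z + w * z\<^sup>2))\<^sup>2 \<le> 3 * ((cmod x)\<^sup>2 + (l * cmod y)\<^sup>2 + (l\<^sup>2 * cmod w)\<^sup>2)" for x y w
  proof -
    have "cmod (x + y * z + w * z\<^sup>2) \<le> cmod x + cmod y * cmod z + cmod w * (cmod z)\<^sup>2"
      by (metis (no_types, lifting) add_right_mono norm_mult norm_power norm_triangle_ineq norm_triangle_le)
    also have "\<dots> \<le> cmod x + cmod y * l + cmod w * l\<^sup>2"
      using assms by (intro add_mono mult_left_mono power_mono) auto
    finally have "(cmod (x + y * z + w * z\<^sup>2))\<^sup>2 \<le> (cmod x + l * cmod y + l\<^sup>2 * cmod w)\<^sup>2"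
      by (intro power_mono) (auto simp: mult.commute)
    also have "\<dots> \<le> 3 * ((cmod x)\<^sup>2 + (l * cmod y)\<^sup>2 + (l\<^sup>2 * cmod w)\<^sup>2)"
      by (smt (verit, best) sum_squares_bound[of "cmod x" "l * cmod y"] sum_squares_bound[of "cmod x" "l\<^sup>2 * cmod w"]
          sum_squares_bound[of "l * cmod y" "l\<^sup>2 * cmod w"] power2_sum distrib_left distrib_right mult.assoc)
    finally show ?thesis .
  qed
  show ?thesis
    unfolding poly_degree_le_2[OF A2_D(1)[OF assms(1)]] poly_degree_le_2[OF A2_D(2)[OF assms(1)]] scaled_size_def
    using *[of "coeff p 0" "coeff p 1" "coeff p 2"] *[of "coeff q 0" "coeff q 1" "coeff q 2"] by argo
qed

lemma scaled_size_pos: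
  assumes "(p, q) \<in> A2" "l > 0"
  shows "scaled_size l p q > 0"
proof -
  have "0 < (cmod (poly p 0))\<^sup>2 + (cmod (poly q 0))\<^sup>2" using sum_cmod_sq_pos A2_D(4)[OF assms(1)] by blast
  also have "\<dots> \<le> 3 * scaled_size l p q" using quadratic_le_scaled_size[OF assms] assms by simp
  finally show ?thesis by simp
qed

text \<open>The assumption \<open>ge\<close> is the form that the pointwise estimate takes when the
  other map is z/(s l) and |z| < l. Bounding |p|^2 + |q|^2 by the coefficient norm leaves the
  squared modulus of a cubic, and averaging over rotations turns it into the squared norm of its
  coefficients.\<close>

lemma integral_ge_scaled_defect:
  fixes g :: "complex \<Rightarrow> real"
  assumes pq: "(p, q) \<in> A2" and l: "l > 0" and g: "integrable lborel g" and pos: "\<And>z. g z \<ge> 0"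
    and ge: "\<And>z. l / 2 < cmod z \<Longrightarrow> cmod z < l \<Longrightarrow>
       g z \<ge> (cmod (z / of_real l * poly q z - s * poly p z))\<^sup>2 / (l\<^sup>2 * ((cmod (poly p z))\<^sup>2 + (cmod (poly q z))\<^sup>2))"
    and s: "cmod s = 1"
  shows "(\<integral>z. g z \<partial>lborel) \<ge> pi / 256 * (scaled_defect l s p q / scaled_size l p q)"
proof -
  define n where "n = scaled_size l p q"
  define S where "S = scaled_defect l s p q"
  have npos: "n > 0" unfolding n_def using pq l by (rule scaled_size_pos)
  define r where "r = (\<lambda>z. - s * coeff p 0 + (coeff q 0 - s * of_real l * coeff p 1) * z
     + (of_real l * coeff q 1 - s * (of_real l)\<^sup>2 * coeff p 2) * z\<^sup>2 + ((of_real l)\<^sup>2 * coeff q 2) * z^3)"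
  have r: "z / of_real l * poly q z - s * poly p z = r (z / of_real l)" for z
    unfolding poly_degree_le_2[OF A2_D(1)[OF pq]] poly_degree_le_2[OF A2_D(2)[OF pq]] r_def
    using l by (simp add: field_simps power2_eq_square power3_eq_cube)
  have ge': "g z \<ge> (cmod (r (z / of_real l)))\<^sup>2 / (l\<^sup>2 * (3 * n))" if "l / 2 < cmod z" "cmod z < l" for z
  proof -
    have "(cmod (r (z / of_real l)))\<^sup>2 / (l\<^sup>2 * (3 * n)) \<le> (cmod (r (z / of_real l)))\<^sup>2 / (l\<^sup>2 * ((cmod (poly p z))\<^sup>2 + (cmod (poly q z))\<^sup>2))"
      using quadratic_le_scaled_size[OF pq l, of z] that l sum_cmod_sq_pos[OF A2_D(4)[OF pq], of z]
      unfolding n_def by (intro divide_left_mono mult_left_mono mult_pos_pos) auto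
    then show ?thesis using ge[OF that] unfolding r by linarith
  qed
  have "3 * pi / 16 * l\<^sup>2 * (S / 16 / (l\<^sup>2 * (3 * n))) \<le> (\<integral>z. g z \<partial>lborel)"
  proof (rule integral_annulus_ge[OF g pos l])
    fix z assume z: "l / 2 < cmod z" "cmod z < l"
    define \<zeta> where "\<zeta> = z / of_real l"
    have \<zeta>: "cmod \<zeta> \<ge> 1/2" using z l by (simp add: \<zeta>_def norm_divide field_simps)
    have z': "z / of_real l = \<zeta>" "\<i> * z / of_real l = \<i> * \<zeta>" "- z / of_real l = - \<zeta>" "- (\<i> * z) / of_real l = - (\<i> * \<zeta>)"
      by (simp_all add: \<zeta>_def)
    \<comment> \<open>Since |\<zeta>| is at least 1/2, a coefficient of degree at most 3 loses at
      most the factor 8, so 64 after squaring. The factor 4 of \<open>parseval_4\<close> reduces 64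
      to 16, and 3/16 times 1/16 times 1/3 is the final 1/256.\<close>
    have pw: "(cmod x)\<^sup>2 \<le> 64 * (cmod x * cmod \<zeta> ^ k)\<^sup>2" if "k \<le> 3" for k x
    proof -
      have "(1/2::real)^3 \<le> (1/2)^k" using that by (intro power_decreasing) auto
      also have "\<dots> \<le> cmod \<zeta> ^ k" using \<zeta> by (intro power_mono) auto
      finally have "cmod x \<le> 8 * (cmod x * cmod \<zeta> ^ k)" 
        using mult_left_mono[of 1 "8 * cmod \<zeta> ^ k" "cmod x"] by (simp add: power3_eq_cube)
      then have "(cmod x)\<^sup>2 \<le> (8 * (cmod x * cmod \<zeta> ^ k))\<^sup>2" by (intro power_mono) auto
      then show ?thesis by (simp add: power_mult_distrib)
    qed
    have k: "(0::nat) \<le> 3" "(1::nat) \<le> 3" "(2::nat) \<le> 3" "(3::nat) \<le> 3" by auto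
    have s0: "cmod (- s * coeff p 0) = cmod (coeff p 0)" using s by (simp add: norm_mult)
    have "S \<le> 64 * ((cmod (- s * coeff p 0))\<^sup>2 + (cmod (coeff q 0 - s * of_real l * coeff p 1) * cmod \<zeta>)\<^sup>2
       + (cmod (of_real l * coeff q 1 - s * (of_real l)\<^sup>2 * coeff p 2) * (cmod \<zeta>)\<^sup>2)\<^sup>2 + (cmod ((of_real l)\<^sup>2 * coeff q 2) * cmod \<zeta> ^ 3)\<^sup>2)"
      using pw[OF k(1), of "- s * coeff p 0"] pw[OF k(2), of "coeff q 0 - s * of_real l * coeff p 1"]
        pw[OF k(3), of "of_real l * coeff q 1 - s * (of_real l)\<^sup>2 * coeff p 2"]
        pw[OF k(4), of "(of_real l)\<^sup>2 * coeff q 2"]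
      unfolding S_def scaled_defect_def s0 power_0 power_one_right mult_1_right distrib_left by (intro add_mono)
    then have "S / 16 \<le> (cmod (r \<zeta>))\<^sup>2 + (cmod (r (\<i> * \<zeta>)))\<^sup>2 + (cmod (r (- \<zeta>)))\<^sup>2 + (cmod (r (- (\<i> * \<zeta>))))\<^sup>2"
      unfolding r_def parseval_4 by linarith
    then have "S / 16 / (l\<^sup>2 * (3 * n)) \<le> ((cmod (r \<zeta>))\<^sup>2 + (cmod (r (\<i> * \<zeta>)))\<^sup>2 + (cmod (r (- \<zeta>)))\<^sup>2 + (cmod (r (- (\<i> * \<zeta>))))\<^sup>2) / (l\<^sup>2 * (3 * n))"
      using npos by (intro divide_right_mono) auto
    also have "\<dots> \<le> g z + g (\<i> * z) + g (- z) + g (- (\<i> * z))"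
      using ge'[of z] ge'[of "\<i> * z"] ge'[of "- z"] ge'[of "- (\<i> * z)"] z
      unfolding z' add_divide_distrib by (simp add: norm_mult)
    finally show "S / 16 / (l\<^sup>2 * (3 * n)) \<le> g z + g (\<i> * z) + g (- z) + g (- (\<i> * z))" .
  qed
  moreover have "3 * pi / 16 * l\<^sup>2 * (S / 16 / (l\<^sup>2 * (3 * n))) = pi / 256 * (S / n)"
    using l npos by simp
  ultimately show ?thesis unfolding S_def n_def by simp
qed

text \<open>The threshold 400 is 20^2: after taking roots each coefficient of the defect is at most
  a twentieth of the sum \<open>m\<close> of all moduli. As |s| = 1, the reverse triangle inequality
  removes the phases and leaves linear inequalities between moduli.\<close>

lemma scaled_defect_small_imp:
  assumes S: "scaled_defect l s p q < scaled_size l p q / 400" and s: "cmod s = 1" and l: "l > 0"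
  defines "m \<equiv> cmod (coeff p 0) + cmod (coeff q 0) + l * cmod (coeff p 1) + l * cmod (coeff q 1)
     + l\<^sup>2 * cmod (coeff p 2) + l\<^sup>2 * cmod (coeff q 2)"
  shows "20 * cmod (coeff p 0) \<le> m" "20 * (l\<^sup>2 * cmod (coeff q 2)) \<le> m"
    "20 * \<bar>cmod (coeff q 0) - l * cmod (coeff p 1)\<bar> \<le> m"
    "20 * \<bar>l * cmod (coeff q 1) - l\<^sup>2 * cmod (coeff p 2)\<bar> \<le> m" "m > 0"
proof -
  have m0: "m \<ge> 0" unfolding m_def using l by auto
  have nm: "scaled_size l p q \<le> m\<^sup>2"
  proof -
    have *: "a\<^sup>2 + b\<^sup>2 + c\<^sup>2 + d\<^sup>2 + e\<^sup>2 + f\<^sup>2 \<le> (a + b + c + d + e + f)\<^sup>2"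
      if "a \<ge> 0" "b \<ge> 0" "c \<ge> 0" "d \<ge> 0" "e \<ge> 0" "f \<ge> 0" for a b c d e f :: real
    proof -
      have "x\<^sup>2 + y\<^sup>2 \<le> (x + y)\<^sup>2" if "x \<ge> 0" "y \<ge> 0" for x y :: real using that by (simp add: power2_sum)
      from this[of a b] this[of "a + b" c] this[of "a + b + c" d] this[of "a + b + c + d" e] this[of "a + b + c + d + e" f] 
      show ?thesis using that by linarith
    qed
    show ?thesis unfolding scaled_size_def m_def using l by (intro *) auto
  qed
  have tr: "20 * x \<le> m" if "x\<^sup>2 \<le> scaled_defect l s p q" for x
  proof -
    have "(20 * x)\<^sup>2 \<le> m\<^sup>2" using that S nm by (simp add: power_mult_distrib)
    then show ?thesis using m0 by (rule power2_le_imp_le)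
  qed
  have tr': "20 * x \<le> m" if "x \<le> y" "20 * y \<le> m" for x y
    using that by linarith
  have S0: "scaled_defect l s p q \<ge> 0" unfolding scaled_defect_def by simp
  show "m > 0" using m0 S0 S nm by (cases "m = 0") auto
  show "20 * cmod (coeff p 0) \<le> m" by (rule tr) (simp add: scaled_defect_def)
  show "20 * (l\<^sup>2 * cmod (coeff q 2)) \<le> m" by (rule tr) (simp add: scaled_defect_def norm_mult norm_power)
  have "\<bar>cmod (coeff q 0) - l * cmod (coeff p 1)\<bar> \<le> cmod (coeff q 0 - s * of_real l * coeff p 1)"
    using norm_triangle_ineq3[of "coeff q 0" "s * of_real l * coeff p 1"] s l by (simp add: norm_mult)
  moreover have "20 * cmod (coeff q 0 - s * of_real l * coeff p 1) \<le> m" by (rule tr) (simp add: scaled_defect_def)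
  ultimately show "20 * \<bar>cmod (coeff q 0) - l * cmod (coeff p 1)\<bar> \<le> m" by (rule tr')
  have "\<bar>l * cmod (coeff q 1) - l\<^sup>2 * cmod (coeff p 2)\<bar> \<le> cmod (of_real l * coeff q 1 - s * (of_real l)\<^sup>2 * coeff p 2)"
    using norm_triangle_ineq3[of "of_real l * coeff q 1" "s * (of_real l)\<^sup>2 * coeff p 2"] s l by (simp add: norm_mult norm_power)
  moreover have "20 * cmod (of_real l * coeff q 1 - s * (of_real l)\<^sup>2 * coeff p 2) \<le> m" by (rule tr) (simp add: scaled_defect_def)
  ultimately show "20 * \<bar>l * cmod (coeff q 1) - l\<^sup>2 * cmod (coeff p 2)\<bar> \<le> m" by (rule tr')
qed

text \<open>A small defect at scale l makes |q0| close to l|p1| and |q1| close to l|p2|, up to an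
  error that is small against the dominant pair. For that pair the ratio cannot be close both to 1
  and to \<open>L\<close>.\<close>

lemma scaled_defect_two_scales:
  assumes L: "L \<ge> 10" and s: "cmod s = 1" "cmod s' = 1"
  shows "scaled_defect 1 s p q \<ge> scaled_size 1 p q / 400 \<or> scaled_defect L s' p q \<ge> scaled_size L p q / 400"
proof (rule ccontr)
  assume "\<not> ?thesis"
  then have S: "scaled_defect 1 s p q < scaled_size 1 p q / 400" "scaled_defect L s' p q < scaled_size L p q / 400" by auto
  define a b x y u v where "a = cmod (coeff p 0)" and "b = cmod (coeff q 2)" and "x = cmod (coeff q 0)"
    and "y = cmod (coeff p 1)" and "u = cmod (coeff q 1)" and "v = cmod (coeff p 2)"
  note d = a_def[symmetric] b_def[symmetric] x_def[symmetric] y_def[symmetric] u_def[symmetric] v_def[symmetric]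
  have nn: "a \<ge> 0" "b \<ge> 0" "x \<ge> 0" "y \<ge> 0" "u \<ge> 0" "v \<ge> 0"
    unfolding a_def b_def x_def y_def u_def v_def by auto
  note 1 = scaled_defect_small_imp[OF S(1) s(1) zero_less_one, unfolded d, simplified]
  have "L > 0" using L by simp
  note 2 = scaled_defect_small_imp[OF S(2) s(2) this, unfolded d]
  define Y U V X where "Y = L * y" and "U = L * u" and "V = L\<^sup>2 * v" and "X = L\<^sup>2 * b"
  note 2 = 2[folded Y_def U_def V_def X_def]
  show False
  \<comment> \<open>Comparing \<open>u\<close> with \<open>y\<close> is the same as comparing
    \<open>U\<close> with \<open>Y\<close>, so the same pair dominates at both scales. The larger of
    \<open>u\<close> and \<open>y\<close> is at least a fifth of the sum, hence an error of a
    twentieth of the sum is at most a quarter of it.\<close>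
  proof (cases "u \<le> y")
    case True
    then have "U \<le> Y" "10 * y \<le> Y" unfolding U_def Y_def using L nn by (auto intro: mult_left_mono mult_right_mono)
    then show False using 1 2 nn True by argo
  next
    case False
    then have UV: "Y \<le> U" "10 * u \<le> U" "10 * (L * v) \<le> V" 
      unfolding U_def Y_def V_def power2_eq_square using L nn by (auto intro: mult_left_mono mult_right_mono)
    have "v \<ge> 3/4 * u" using 1 nn False by argo
    then have "L * v \<ge> 3/4 * U" unfolding U_def using L by (simp add: mult_left_mono)
    then show False using 1 2 nn False UV by argo
  qed
qed

section \<open>Two bubbles joined by a neck\<close>

definition sq_pos :: "real \<Rightarrow> real" where
  "sq_pos x = (max 0 x)\<^sup>2"

lemma DERIV_sq_pos: "(sq_pos has_real_derivative 2 * max 0 x) (at x)"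
proof -
  consider "x < 0" | "x > 0" | "x = 0" by linarith
  then show ?thesis
  proof cases
    case 1
    have "((\<lambda>x. 0) has_real_derivative 2 * max 0 x) (at x)" using 1 by (auto intro!: derivative_eq_intros)
    then show ?thesis
      by (rule has_field_derivative_transform_within_open[where S = "{..<0}"]) (use 1 in \<open>auto simp: sq_pos_def\<close>)
  next
    case 2
    have "((\<lambda>x. x\<^sup>2) has_real_derivative 2 * max 0 x) (at x)" using 2 by (auto intro!: derivative_eq_intros)
    then show ?thesis
      by (rule has_field_derivative_transform_within_open[where S = "{0<..}"]) (use 2 in \<open>auto simp: sq_pos_def\<close>)
  next
    case 3
    have "((\<lambda>y. (sq_pos y - sq_pos 0) / (y - 0)) \<longlongrightarrow> 0) (at 0)"
    proof (rule Lim_null_comparison)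
      show "\<forall>\<^sub>F y in at 0. norm ((sq_pos y - sq_pos 0) / (y - 0)) \<le> \<bar>y\<bar>"
        by (intro always_eventually allI) (auto simp: sq_pos_def max_def power2_eq_square)
      show "((\<lambda>y. \<bar>y\<bar>) \<longlongrightarrow> (0::real)) (at 0)" by (auto intro!: tendsto_eq_intros)
    qed
    then show ?thesis using 3 by (simp add: has_field_derivative_iff)
  qed
qed

text \<open>The quadratic spline with knots 0, 1/2, 1 that rises from 0 to 1; its derivative is a
  tent of height 2. Being differentiable at the knots, it makes the final map differentiable
  everywhere.\<close>

definition smooth_step :: "real \<Rightarrow> real" where
  "smooth_step x = 2 * sq_pos x - 4 * sq_pos (x - 1/2) + 2 * sq_pos (x - 1)"

definition smooth_step' :: "real \<Rightarrow> real" where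
  "smooth_step' x = 4 * max 0 x - 8 * max 0 (x - 1/2) + 4 * max 0 (x - 1)"

lemma DERIV_smooth_step: "(smooth_step has_real_derivative smooth_step' x) (at x)"
  unfolding smooth_step_def[abs_def] smooth_step'_def
  by (auto intro!: derivative_eq_intros DERIV_chain2[OF DERIV_sq_pos])

lemma smooth_step'_bounds: "0 \<le> smooth_step' x" "smooth_step' x \<le> 2"
  unfolding smooth_step'_def by (auto simp: max_def)

lemma smooth_step'_eq_0: "x \<le> 0 \<or> x \<ge> 1 \<Longrightarrow> smooth_step' x = 0"
  unfolding smooth_step'_def by (auto simp: max_def)

lemma smooth_step_eq_0: "x \<le> 0 \<Longrightarrow> smooth_step x = 0"
  unfolding smooth_step_def sq_pos_def by (auto simp: max_def)

lemma smooth_step_eq_1: "x \<ge> 1 \<Longrightarrow> smooth_step x = 1"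
  unfolding smooth_step_def sq_pos_def by (auto simp: max_def power2_eq_square algebra_simps)

lemma smooth_step_mono: "x \<le> y \<Longrightarrow> smooth_step x \<le> smooth_step y"
  by (rule DERIV_nonneg_imp_nondecreasing) (use DERIV_smooth_step smooth_step'_bounds in blast)+

lemma smooth_step_bounds: "0 \<le> smooth_step x" "smooth_step x \<le> 1"
  using smooth_step_mono[of "min x 0" x] smooth_step_mono[of x "max x 1"]
    smooth_step_eq_0[of "min x 0"] smooth_step_eq_1[of "max x 1"] by auto

lemma measurable_smooth_step [measurable]:
  "smooth_step \<in> borel_measurable borel" "smooth_step' \<in> borel_measurable borel"
  unfolding smooth_step_def[abs_def] smooth_step'_def[abs_def] sq_pos_def by measurable

section \<open>The cutoffs and the map built from them\<close>

locale neck =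
  fixes l :: real
  assumes l: "l \<ge> 1"
begin

text \<open>With \<open>x = log_scale t\<close>, the inner cutoff falls on \<open>1 \<le> x \<le> 2\<close>, the sphere turns on
  \<open>2 \<le> x \<le> 3\<close>, and the outer cutoff rises on \<open>3 \<le> x \<le> 4\<close>. While the sphere turns, both cutoffs
  vanish and the unturned map \<open>[z : neck_q z]\<close> is constant, so turning does not affect the degree density.\<close>

definition log_scale :: "real \<Rightarrow> real" where "log_scale t = ln (1 + t) / l"
definition inner_cut :: "real \<Rightarrow> real" where "inner_cut t = 1 - smooth_step (log_scale t - 1)"
definition angle :: "real \<Rightarrow> real" where "angle t = pi / 2 * smooth_step (log_scale t - 2)"
definition outer_cut :: "real \<Rightarrow> real" where "outer_cut t = exp (- 3 * l) * smooth_step (log_scale t - 3)"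
definition inner_cut' :: "real \<Rightarrow> real" where
  "inner_cut' t = - smooth_step' (log_scale t - 1) / (l * (1 + t))"
definition angle' :: "real \<Rightarrow> real" where
  "angle' t = pi / 2 * smooth_step' (log_scale t - 2) / (l * (1 + t))"
definition outer_cut' :: "real \<Rightarrow> real" where
  "outer_cut' t = exp (- 3 * l) * smooth_step' (log_scale t - 3) / (l * (1 + t))"

lemma DERIV_log_scale: "t \<ge> 0 \<Longrightarrow> (log_scale has_real_derivative 1 / (l * (1 + t))) (at t)"
  unfolding log_scale_def[abs_def] using l by (auto intro!: derivative_eq_intros)

lemma DERIV_smooth_step_log_scale:
  "t \<ge> 0 \<Longrightarrow> ((\<lambda>t. smooth_step (log_scale t - k)) has_real_derivative
     smooth_step' (log_scale t - k) / (l * (1 + t))) (at t)"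
  using DERIV_chain2[OF DERIV_smooth_step DERIV_diff[OF DERIV_log_scale DERIV_const]] by simp

lemma DERIV_cuts:
  assumes "t \<ge> 0"
  shows "(inner_cut has_real_derivative inner_cut' t) (at t)"
    "(angle has_real_derivative angle' t) (at t)"
    "(outer_cut has_real_derivative outer_cut' t) (at t)"
  unfolding inner_cut_def[abs_def] angle_def[abs_def] outer_cut_def[abs_def] inner_cut'_def angle'_def outer_cut'_def
  using DERIV_diff[OF DERIV_const[of 1] DERIV_smooth_step_log_scale[OF assms, of 1]]
    DERIV_cmult[OF DERIV_smooth_step_log_scale[OF assms, of 2], of "pi / 2"]
    DERIV_cmult[OF DERIV_smooth_step_log_scale[OF assms, of 3], of "exp (- 3 * l)"]
  by simp_all

lemma outer_log_scale:
  assumes "1 + t \<ge> exp (4 * l)"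
  shows "log_scale t \<ge> 4"
proof -
  have "4 * l \<le> ln (1 + t)" using assms by (metis exp_gt_zero ln_exp ln_le_cancel_iff order_less_le_trans)
  then show ?thesis using l by (simp add: log_scale_def le_divide_eq)
qed

lemma measurable_cuts [measurable]:
  "inner_cut \<in> borel_measurable borel" "outer_cut \<in> borel_measurable borel"
  "inner_cut' \<in> borel_measurable borel" "outer_cut' \<in> borel_measurable borel"
  unfolding inner_cut_def[abs_def] outer_cut_def[abs_def] inner_cut'_def[abs_def] outer_cut'_def[abs_def] log_scale_def[abs_def]
  by measurable

lemma cuts_inner:
  assumes "log_scale t \<le> 2"
  shows "angle t = 0" "angle' t = 0" "outer_cut t = 0" "outer_cut' t = 0"
  using assms by (simp_all add: angle_def angle'_def outer_cut_def outer_cut'_def smooth_step_eq_0 smooth_step'_eq_0)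

lemma cuts_neck:
  assumes "2 \<le> log_scale t" "log_scale t \<le> 3"
  shows "inner_cut t = 0" "inner_cut' t = 0" "outer_cut t = 0" "outer_cut' t = 0"
  using assms
  by (simp_all add: inner_cut_def inner_cut'_def outer_cut_def outer_cut'_def
      smooth_step_eq_1 smooth_step_eq_0 smooth_step'_eq_0)

lemma cuts_outer:
  assumes "3 \<le> log_scale t"
  shows "inner_cut t = 0" "inner_cut' t = 0" "angle t = pi / 2" "angle' t = 0"
  using assms by (simp_all add: inner_cut_def inner_cut'_def angle_def angle'_def smooth_step_eq_1 smooth_step'_eq_0)

lemma cuts_sign:
  assumes "t \<ge> 0"
  shows "inner_cut t \<ge> 0" "inner_cut' t \<le> 0" "outer_cut t \<ge> 0" "outer_cut' t \<ge> 0"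
  using assms l smooth_step_bounds smooth_step'_bounds
  by (simp_all add: inner_cut_def inner_cut'_def outer_cut_def outer_cut'_def divide_nonpos_pos)

lemma cuts_disjoint:
  "inner_cut t * outer_cut t = 0" "inner_cut t * outer_cut' t = 0" "inner_cut' t * outer_cut t = 0"
  using cuts_inner[of t] cuts_neck[of t] cuts_outer[of t]
  by (cases "log_scale t \<le> 2"; cases "log_scale t \<le> 3"; simp)+

text \<open>The quotient z/q is z on the inner bubble, infinity on the neck, and 1/(e z) with e =
  exp(-3l) far out.\<close>

definition neck_q :: "complex \<Rightarrow> complex" where
  "neck_q z = of_real (inner_cut ((cmod z)\<^sup>2)) + of_real (outer_cut ((cmod z)\<^sup>2)) * z\<^sup>2"

text \<open>A real rotation of the homogeneous coordinates by the angle a turns the sphere by 2a, so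
  the final angle \<pi>/2 carries the north pole to the south pole. It changes 1/(e z) into -e
  z.\<close>

definition neck_P :: "complex \<Rightarrow> complex" where
  "neck_P z = of_real (cos (angle ((cmod z)\<^sup>2))) * z - of_real (sin (angle ((cmod z)\<^sup>2))) * neck_q z"

definition neck_Q :: "complex \<Rightarrow> complex" where
  "neck_Q z = of_real (sin (angle ((cmod z)\<^sup>2))) * z + of_real (cos (angle ((cmod z)\<^sup>2))) * neck_q z"

definition neck_map :: "complex \<Rightarrow> real^3" where
  "neck_map z = hopf (neck_P z) (neck_Q z)"

definition neck_dens_num :: "real \<Rightarrow> real" where
  "neck_dens_num t = (inner_cut t)\<^sup>2 - 2 * t * inner_cut t * inner_cut' t
     + t\<^sup>2 * ((outer_cut t)\<^sup>2 + 2 * t * outer_cut t * outer_cut' t)"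

definition neck_N :: "real \<Rightarrow> real" where
  "neck_N t = t + (inner_cut t)\<^sup>2 + (t * outer_cut t)\<^sup>2"

lemma cmod_neck_q: "(cmod (neck_q z))\<^sup>2 = (inner_cut ((cmod z)\<^sup>2))\<^sup>2 + ((cmod z)\<^sup>2 * outer_cut ((cmod z)\<^sup>2))\<^sup>2"
proof -
  have "inner_cut ((cmod z)\<^sup>2) = 0 \<or> outer_cut ((cmod z)\<^sup>2) = 0" using cuts_disjoint(1) by simp
  then show ?thesis by (auto simp: neck_q_def norm_mult norm_power mult.commute power_mult_distrib)
qed

lemma neck_PQ: "(cmod (neck_P z))\<^sup>2 + (cmod (neck_Q z))\<^sup>2 = neck_N ((cmod z)\<^sup>2)"
proof -
  have "(cmod (of_real c * z - of_real s * q))\<^sup>2 + (cmod (of_real s * z + of_real c * q))\<^sup>2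
     = (s\<^sup>2 + c\<^sup>2) * ((cmod z)\<^sup>2 + (cmod q)\<^sup>2)" for c s q
    unfolding cmod_power2 by (simp add: power2_eq_square algebra_simps)
  then have *: "(cmod (of_real (cos a) * z - of_real (sin a) * q))\<^sup>2 + (cmod (of_real (sin a) * z + of_real (cos a) * q))\<^sup>2
     = (cmod z)\<^sup>2 + (cmod q)\<^sup>2" for a q
    by simp
  show ?thesis unfolding neck_P_def neck_Q_def * cmod_neck_q neck_N_def by simp
qed

lemma neck_N_pos: "t \<ge> 0 \<Longrightarrow> neck_N t > 0"
proof (cases "t = 0")
  case True
  then show ?thesis by (simp add: neck_N_def inner_cut_def log_scale_def smooth_step_eq_0)
next
  case False
  then show "t \<ge> 0 \<Longrightarrow> neck_N t > 0" by (auto simp: neck_N_def intro!: add_pos_nonneg)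
qed

lemma neck_nz: "neck_P z \<noteq> 0 \<or> neck_Q z \<noteq> 0"
  using neck_PQ[of z] neck_N_pos[of "(cmod z)\<^sup>2"] by auto

section \<open>Energy and degree densities of the neck map\<close>

lemma has_derivative_radial:
  fixes f :: "real \<Rightarrow> real"
  assumes "(f has_real_derivative d) (at ((cmod z)\<^sup>2))"
  shows "((\<lambda>z. complex_of_real (f ((cmod z)\<^sup>2))) has_derivative (\<lambda>h. of_real d * (cnj z * h + z * cnj h))) (at z)"
proof -
  have "((\<lambda>z. (cmod z)\<^sup>2) has_derivative (\<lambda>h. 2 * Re (cnj z * h))) (at z)"
    unfolding cmod_power2 by (rule derivative_eq_intros refl | simp add: fun_eq_iff algebra_simps)+
  from has_derivative_of_real[OF DERIV_compose_FDERIV[OF assms this], where ?'a = complex]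
  have "((\<lambda>z. complex_of_real (f ((cmod z)\<^sup>2))) has_derivative (\<lambda>h. of_real (2 * Re (cnj z * h) * d))) (at z)" .
  moreover have "complex_of_real (2 * Re (cnj z * h) * d) = of_real d * (cnj z * h + z * cnj h)" for h
    by (simp add: complex_eq_iff algebra_simps)
  ultimately show ?thesis by (simp only:)
qed

context
  fixes z :: complex and t :: real
  assumes t_def: "t = (cmod z)\<^sup>2"
begin

text \<open>Coefficients of dz and d(cnj z) in q dz - z dq - (z^2 + q^2) da, with q =
  \<open>neck_q z\<close> and a the angle. The first two terms are the form of the unturned map,
  which a constant rotation preserves; the last comes from the variation of the angle.\<close>

definition neck_\<alpha> :: complex where
  "neck_\<alpha> = neck_q z - z * (of_real (inner_cut' t) * cnj z + of_real (outer_cut' t) * cnj z * z\<^sup>2 + 2 * of_real (outer_cut t) * z)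
     - (z\<^sup>2 + (neck_q z)\<^sup>2) * of_real (angle' t) * cnj z"

definition neck_\<beta> :: complex where
  "neck_\<beta> = - z * (of_real (inner_cut' t) * z + of_real (outer_cut' t) * z ^ 3)
     - (z\<^sup>2 + (neck_q z)\<^sup>2) * of_real (angle' t) * z"

lemma neck_derivatives:
  obtains P' Q' where "(neck_P has_derivative P') (at z)" "(neck_Q has_derivative Q') (at z)"
    "\<And>h. neck_Q z * P' h - neck_P z * Q' h = neck_\<alpha> * h + neck_\<beta> * cnj h"
proof -
  have t0: "t \<ge> 0" unfolding t_def by simp
  define \<tau> where "\<tau> = (\<lambda>h. cnj z * h + z * cnj h)"
  define dq where "dq = (\<lambda>h. of_real (inner_cut' t) * \<tau> h + (of_real (outer_cut' t) * \<tau> h * z\<^sup>2 + of_real (outer_cut t) * (2 * z * h)))"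
  define c s where "c = complex_of_real (cos (angle t))" and "s = complex_of_real (sin (angle t))"
  have cs: "c\<^sup>2 + s\<^sup>2 = 1"
    unfolding c_def s_def by (metis add.commute of_real_1 of_real_add of_real_power sin_cos_squared_add)
  note D = DERIV_cuts[OF t0]
  have dcos: "((\<lambda>t. cos (angle t)) has_real_derivative - sin (angle t) * angle' t) (at t)"
    and dsin: "((\<lambda>t. sin (angle t)) has_real_derivative cos (angle t) * angle' t) (at t)"
    by (rule derivative_eq_intros D refl | simp)+
  note R = has_derivative_radial[OF D(1)[unfolded t_def]] has_derivative_radial[OF D(3)[unfolded t_def]]
    has_derivative_radial[OF dcos[unfolded t_def]] has_derivative_radial[OF dsin[unfolded t_def]]
  have q: "(neck_q has_derivative dq) (at z)"
    unfolding neck_q_def[abs_def] dq_def \<tau>_def t_def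
    by (rule derivative_eq_intros R refl | simp add: fun_eq_iff algebra_simps)+
  define P' where "P' = (\<lambda>h. - s * of_real (angle' t) * \<tau> h * z + c * h - (c * of_real (angle' t) * \<tau> h * neck_q z + s * dq h))"
  define Q' where "Q' = (\<lambda>h. c * of_real (angle' t) * \<tau> h * z + s * h + (- s * of_real (angle' t) * \<tau> h * neck_q z + c * dq h))"
  have "(neck_P has_derivative P') (at z)"
    unfolding neck_P_def[abs_def] P'_def c_def s_def \<tau>_def t_def
    by (rule derivative_eq_intros R q refl | simp add: fun_eq_iff algebra_simps)+
  moreover have "(neck_Q has_derivative Q') (at z)"
    unfolding neck_Q_def[abs_def] Q'_def c_def s_def \<tau>_def t_def
    by (rule derivative_eq_intros R q refl | simp add: fun_eq_iff algebra_simps)+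
  moreover have "neck_Q z * P' h - neck_P z * Q' h = neck_\<alpha> * h + neck_\<beta> * cnj h" for h
  proof -
    have PQ: "neck_P z = c * z - s * neck_q z" "neck_Q z = s * z + c * neck_q z"
      unfolding neck_P_def neck_Q_def c_def s_def t_def by auto
    have "neck_Q z * P' h - neck_P z * Q' h = (neck_q z * h - z * dq h) - (z\<^sup>2 + (neck_q z)\<^sup>2) * of_real (angle' t) * \<tau> h"
      unfolding PQ P'_def Q'_def using cs by algebra
    also have "\<dots> = neck_\<alpha> * h + neck_\<beta> * cnj h"
      unfolding dq_def \<tau>_def neck_\<alpha>_def neck_\<beta>_def by algebra
    finally show ?thesis .
  qed
  ultimately show ?thesis using that by blast
qed

lemma neck_map_differentiable: "neck_map differentiable (at z)"
proof (rule neck_derivatives)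
  fix P' Q' assume "(neck_P has_derivative P') (at z)" "(neck_Q has_derivative Q') (at z)"
  from has_derivative_hopf[OF this neck_nz] show ?thesis
    unfolding neck_map_def[abs_def] differentiable_def by blast
qed

lemma neck_map_densities:
  "grad_sq neck_map z = 8 * ((cmod neck_\<alpha>)\<^sup>2 + (cmod neck_\<beta>)\<^sup>2) / (neck_N t)\<^sup>2"
  "neck_map z \<bullet> cross3 (partial_y neck_map z) (partial_x neck_map z) = 4 * ((cmod neck_\<alpha>)\<^sup>2 - (cmod neck_\<beta>)\<^sup>2) / (neck_N t)\<^sup>2"
proof -
  obtain P' Q' where *: "(neck_P has_derivative P') (at z)" "(neck_Q has_derivative Q') (at z)"
    "\<And>h. neck_Q z * P' h - neck_P z * Q' h = neck_\<alpha> * h + neck_\<beta> * cnj h"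
    using neck_derivatives by blast
  show "grad_sq neck_map z = 8 * ((cmod neck_\<alpha>)\<^sup>2 + (cmod neck_\<beta>)\<^sup>2) / (neck_N t)\<^sup>2"
    "neck_map z \<bullet> cross3 (partial_y neck_map z) (partial_x neck_map z) = 4 * ((cmod neck_\<alpha>)\<^sup>2 - (cmod neck_\<beta>)\<^sup>2) / (neck_N t)\<^sup>2"
    using grad_sq_hopf[OF *(1,2) neck_nz *(3)] unfolding neck_PQ neck_map_def[abs_def] t_def by auto
qed

text \<open>Before and after the neck the angle is constant and only one cutoff is present, so
  \<alpha> and \<beta> are powers of z times real radial functions. On the neck q = 0, and the
  turning term contributes equally to |\<alpha>| and |\<beta>|.\<close>

lemma neck_dens_num_eq: "(cmod neck_\<alpha>)\<^sup>2 - (cmod neck_\<beta>)\<^sup>2 = neck_dens_num t"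
proof -
  have zz: "z * cnj z = of_real t" unfolding t_def by (rule complex_norm_square[symmetric])
  consider "log_scale t \<le> 2" | "2 \<le> log_scale t" "log_scale t \<le> 3" | "3 \<le> log_scale t" by linarith
  then show ?thesis
  proof cases
    case 1
    note c = cuts_inner[OF 1]
    have "neck_\<alpha> = of_real (inner_cut t) - z * cnj z * of_real (inner_cut' t)"
      unfolding neck_\<alpha>_def neck_q_def using c by (simp add: t_def[symmetric])
    then have a: "neck_\<alpha> = of_real (inner_cut t - t * inner_cut' t)" unfolding zz by simp
    have b: "neck_\<beta> = - (z\<^sup>2 * of_real (inner_cut' t))"
      unfolding neck_\<beta>_def using c by (simp add: power2_eq_square)
    have "(cmod neck_\<beta>)\<^sup>2 = (t * inner_cut' t)\<^sup>2"
      unfolding b unfolding t_def by (simp add: norm_mult norm_power power_mult_distrib)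
    moreover have "(cmod neck_\<alpha>)\<^sup>2 = (inner_cut t - t * inner_cut' t)\<^sup>2" unfolding a by (metis norm_of_real power2_abs)
    ultimately show ?thesis unfolding neck_dens_num_def using c by (simp add: power2_eq_square algebra_simps)
  next
    case 2
    note c = cuts_neck[OF 2]
    have "cmod neck_\<alpha> = cmod neck_\<beta>"
      unfolding neck_\<alpha>_def neck_\<beta>_def neck_q_def using c by (simp add: t_def[symmetric] norm_mult)
    then show ?thesis using c by (simp add: neck_dens_num_def)
  next
    case 3
    note c = cuts_outer[OF 3]
    have q: "neck_q z = of_real (outer_cut t) * z\<^sup>2"
      unfolding neck_q_def using c by (simp add: t_def[symmetric])
    have "neck_\<alpha> = - (z\<^sup>2 * (of_real (outer_cut t) + z * cnj z * of_real (outer_cut' t)))"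
      unfolding neck_\<alpha>_def q using c by (simp add: power2_eq_square algebra_simps)
    then have a: "neck_\<alpha> = - (z\<^sup>2 * of_real (outer_cut t + t * outer_cut' t))" unfolding zz by simp
    have b: "neck_\<beta> = - (z ^ 4 * of_real (outer_cut' t))"
      unfolding neck_\<beta>_def using c by (simp add: eval_nat_numeral algebra_simps)
    have "cmod z ^ 4 = t\<^sup>2" unfolding t_def by simp
    then have "(cmod neck_\<beta>)\<^sup>2 = (t\<^sup>2 * outer_cut' t)\<^sup>2"
      unfolding b by (simp add: norm_mult norm_power power_mult_distrib)
    moreover have "(cmod neck_\<alpha>)\<^sup>2 = (t * (outer_cut t + t * outer_cut' t))\<^sup>2"
      unfolding a norm_minus_cancel norm_mult norm_power norm_of_real power_mult_distrib power2_abs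
      by (simp add: t_def)
    ultimately show ?thesis unfolding neck_dens_num_def using c by (simp add: power2_eq_square algebra_simps)
  qed
qed

text \<open>Only derivatives of the cutoffs and of the angle enter \<beta>, each carrying the factor
  1/(l(1 + t)), and all of them vanish once \<open>log_scale t\<close> reaches 4. The remaining
  factor t^2 is absorbed by the denominator, as \<open>neck_N t\<close> is at least t.\<close>

lemma neck_\<beta>_bound: "(cmod neck_\<beta>)\<^sup>2 / (neck_N t)\<^sup>2 \<le> pi\<^sup>2 / l\<^sup>2 / (1 + t) * indicator {0..exp (4 * l)} t"
proof -
  have t0: "t \<ge> 0" unfolding t_def by simp
  \<comment> \<open>The turn produces \<pi>^2 and the cutoffs produce 4, so one bound with \<pi>^2
    serves all three regions.\<close>
  have pi4: "4 \<le> pi\<^sup>2" using power_mono[of 2 pi 2] pi_ge_two by simp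
  define K where "K = pi\<^sup>2 / l\<^sup>2 / (1 + t) * indicator {0..exp (4 * l)} t"
  have "(cmod neck_\<beta>)\<^sup>2 \<le> t\<^sup>2 * K"
  proof (cases "log_scale t \<ge> 4")
    case True
    have "neck_\<beta> = 0" unfolding neck_\<beta>_def
      using True by (simp add: inner_cut'_def angle'_def outer_cut'_def smooth_step'_eq_0)
    then show ?thesis using t0 by (simp add: K_def)
  next
    case False
    then have te: "1 + t \<le> exp (4 * l)"
      using outer_log_scale[of t] by linarith
    then have K: "K = pi\<^sup>2 / (l\<^sup>2 * (1 + t))" using t0 by (simp add: K_def)
    have sb: "(smooth_step' x / (l * (1 + t)))\<^sup>2 \<le> 4 / (l * (1 + t))\<^sup>2" for x
      unfolding power_divide using power_mono[OF smooth_step'_bounds(2,1), of x 2] by (intro divide_right_mono) auto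
    have cancel: "a / (l * (1 + t))\<^sup>2 * (1 + t) = a / (l\<^sup>2 * (1 + t))" for a
      using t0 l unfolding power2_eq_square by simp
    have up: "4 / (l * (1 + t))\<^sup>2 * (1 + t) \<le> K"
    proof -
      have "4 / (l * (1 + t))\<^sup>2 * (1 + t) = 4 / (l\<^sup>2 * (1 + t))"
        by (rule cancel)
      also have "\<dots> \<le> K" unfolding K using pi4 t0 l by (intro divide_right_mono) auto
      finally show ?thesis .
    qed
    have up1: "4 / (l * (1 + t))\<^sup>2 \<le> K"
    proof -
      have "4 / (l * (1 + t))\<^sup>2 * 1 \<le> 4 / (l * (1 + t))\<^sup>2 * (1 + t)" using t0 by (intro mult_left_mono) auto
      then show ?thesis using up by simp
    qed
    consider "log_scale t \<le> 2" | "2 \<le> log_scale t" "log_scale t \<le> 3" | "3 \<le> log_scale t" by linarith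
    then show ?thesis
    proof cases
      case 1
      note c = cuts_inner[OF 1]
      have b: "neck_\<beta> = - (z\<^sup>2 * of_real (inner_cut' t))"
        unfolding neck_\<beta>_def using c by (simp add: power2_eq_square)
      have "(cmod neck_\<beta>)\<^sup>2 = t\<^sup>2 * (inner_cut' t)\<^sup>2"
        unfolding b unfolding t_def by (simp add: norm_mult norm_power power_mult_distrib)
      also have "(inner_cut' t)\<^sup>2 \<le> K" using order_trans[OF sb up1] unfolding inner_cut'_def by simp
      finally show ?thesis by (simp add: mult_left_mono)
    next
      case 2
      note c = cuts_neck[OF 2]
      have q: "neck_q z = 0" unfolding neck_q_def using c by (simp add: t_def[symmetric])
      have b: "neck_\<beta> = - (z ^ 3 * of_real (angle' t))"
        unfolding neck_\<beta>_def q using c by (simp add: eval_nat_numeral)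
      have "(cmod neck_\<beta>)\<^sup>2 = t\<^sup>2 * (t * (angle' t)\<^sup>2)"
        unfolding b unfolding t_def by (simp add: norm_mult norm_power power_mult_distrib eval_nat_numeral)
      also have "t * (angle' t)\<^sup>2 \<le> K"
      proof -
        have "(angle' t)\<^sup>2 = pi\<^sup>2 / 4 * (smooth_step' (log_scale t - 2) / (l * (1 + t)))\<^sup>2"
          unfolding angle'_def by (simp add: power_mult_distrib power_divide)
        also have "\<dots> \<le> pi\<^sup>2 / 4 * (4 / (l * (1 + t))\<^sup>2)" by (intro mult_left_mono sb) auto
        finally have "(angle' t)\<^sup>2 \<le> pi\<^sup>2 / (l * (1 + t))\<^sup>2" by simp
        then have "t * (angle' t)\<^sup>2 \<le> (1 + t) * (pi\<^sup>2 / (l * (1 + t))\<^sup>2)" using t0 by (intro mult_mono) auto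
        also have "\<dots> = K" unfolding K using cancel[of "pi\<^sup>2"] by (metis mult.commute)
        finally show ?thesis .
      qed
      finally show ?thesis by (simp add: mult_left_mono)
    next
      case 3
      note c = cuts_outer[OF 3]
      have b: "neck_\<beta> = - (z ^ 4 * of_real (outer_cut' t))"
        unfolding neck_\<beta>_def using c by (simp add: eval_nat_numeral algebra_simps)
      have z4: "cmod z ^ 4 = t\<^sup>2" unfolding t_def by simp
      have "(cmod neck_\<beta>)\<^sup>2 = t\<^sup>2 * (t\<^sup>2 * (outer_cut' t)\<^sup>2)"
        unfolding b using z4 by (simp add: norm_mult norm_power power_mult_distrib)
      also have "t\<^sup>2 * (outer_cut' t)\<^sup>2 \<le> K"
      proof -
        \<comment> \<open>In the outer region \<beta> carries higher powers of z. The height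
          exp(-3l) of the outer cutoff compensates them, because 1 + t is at most exp(4l)
          there.\<close>
        have ee: "(1 + t) * (exp (- 3 * l))\<^sup>2 \<le> 1"
        proof -
          have "(1 + t) * (exp (- 3 * l))\<^sup>2 \<le> exp (4 * l) * (exp (- 3 * l))\<^sup>2" using te by (intro mult_right_mono) auto
          also have "\<dots> = exp (- 2 * l)" by (simp add: power2_eq_square flip: exp_add)
          also have "\<dots> \<le> 1" using l by simp
          finally show ?thesis .
        qed
        have "t\<^sup>2 * (outer_cut' t)\<^sup>2 = t\<^sup>2 * (exp (- 3 * l))\<^sup>2 * (smooth_step' (log_scale t - 3) / (l * (1 + t)))\<^sup>2"
          unfolding outer_cut'_def by (simp add: power_mult_distrib power_divide)
        also have "\<dots> \<le> (1 + t)\<^sup>2 * (exp (- 3 * l))\<^sup>2 * (4 / (l * (1 + t))\<^sup>2)"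
          using t0 by (intro mult_mono sb) (auto intro!: power_mono)
        also have "\<dots> = ((1 + t) * (exp (- 3 * l))\<^sup>2) * (4 / (l * (1 + t))\<^sup>2 * (1 + t))"
          unfolding power2_eq_square[of "1 + t"] by (simp only: mult_ac)
        also have "\<dots> \<le> 1 * K" using ee up t0 by (intro mult_mono) auto
        finally show ?thesis by simp
      qed
      finally show ?thesis by (simp add: mult_left_mono)
    qed
  qed
  then have "(cmod neck_\<beta>)\<^sup>2 / (neck_N t)\<^sup>2 \<le> t\<^sup>2 * K / (neck_N t)\<^sup>2" by (intro divide_right_mono) auto
  also have "\<dots> \<le> (neck_N t)\<^sup>2 * K / (neck_N t)\<^sup>2"
    using t0 l by (intro divide_right_mono mult_right_mono power_mono) (auto simp: neck_N_def K_def)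
  also have "\<dots> = K" using neck_N_pos[OF t0] by simp
  finally show ?thesis unfolding K_def .
qed

end

section \<open>Degree and energy of the neck map\<close>

lemma DERIV_neck_degree:
  assumes "t \<ge> 0"
  shows "((\<lambda>t. 4 * ((t * outer_cut t)\<^sup>2 - (inner_cut t)\<^sup>2) / neck_N t) has_real_derivative
    4 * neck_dens_num t / (neck_N t)\<^sup>2) (at t)"
proof -
  define a b a' b' N where "a = inner_cut t" and "b = outer_cut t" and "a' = inner_cut' t" and "b' = outer_cut' t"
    and "N = neck_N t"
  have N: "N \<noteq> 0" using neck_N_pos[OF assms] by (simp add: N_def)
  note D = DERIV_cuts[OF assms]
  have dN: "(neck_N has_real_derivative 1 + 2 * a * a' + 2 * (t * b) * (b + t * b')) (at t)"
    unfolding neck_N_def[abs_def] a_def b_def a'_def b'_def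
    by (rule derivative_eq_intros D refl | simp add: algebra_simps)+
  have dn: "((\<lambda>t. 4 * ((t * outer_cut t)\<^sup>2 - (inner_cut t)\<^sup>2)) has_real_derivative
     4 * (2 * (t * b) * (b + t * b') - 2 * a * a')) (at t)"
    unfolding a_def b_def a'_def b'_def
    by (rule derivative_eq_intros D refl | simp add: algebra_simps)+
  \<comment> \<open>At most one cutoff is nonzero, which removes the mixed terms.\<close>
  have "a * b = 0" unfolding a_def b_def by (rule cuts_disjoint)
  then have "4 * (2 * (t * b) * (b + t * b') - 2 * a * a') * N
      - 4 * ((t * b)\<^sup>2 - a\<^sup>2) * (1 + 2 * a * a' + 2 * (t * b) * (b + t * b')) = 4 * neck_dens_num t"
    unfolding N_def neck_N_def neck_dens_num_def a_def[symmetric] b_def[symmetric] a'_def[symmetric] b'_def[symmetric]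
    by algebra
  then show ?thesis
    using DERIV_divide[OF dn dN] N unfolding N_def[symmetric] a_def[symmetric] b_def[symmetric]
    by (simp add: power2_eq_square)
qed

lemma neck_degree_tendsto:
  "((\<lambda>t. 4 * ((t * outer_cut t)\<^sup>2 - (inner_cut t)\<^sup>2) / neck_N t) \<longlongrightarrow> 4) at_top"
proof -
  define e where "e = exp (- 3 * l)"
  have e: "e \<noteq> 0" by (simp add: e_def)
  have "((\<lambda>t. 4 * (e\<^sup>2 / (inverse t + e\<^sup>2))) \<longlongrightarrow> 4 * (e\<^sup>2 / (0 + e\<^sup>2))) at_top"
    using e by (intro tendsto_intros tendsto_inverse_0_at_top filterlim_ident) auto
  then have lim: "((\<lambda>t. 4 * (e\<^sup>2 / (inverse t + e\<^sup>2))) \<longlongrightarrow> 4) at_top" using e by simp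
  show ?thesis
  proof (rule Lim_transform_eventually[OF lim])
    show "\<forall>\<^sub>F t in at_top. 4 * (e\<^sup>2 / (inverse t + e\<^sup>2)) = 4 * ((t * outer_cut t)\<^sup>2 - (inner_cut t)\<^sup>2) / neck_N t"
      using eventually_ge_at_top[of "exp (4 * l)"]
    proof eventually_elim
      case (elim t)
      have t: "t > 0" using elim by (smt (verit) exp_gt_zero)
      have "log_scale t \<ge> 4" using outer_log_scale[of t] elim by simp
      then have "inner_cut t = 0" "outer_cut t = e"
        by (simp_all add: inner_cut_def outer_cut_def smooth_step_eq_1 e_def)
      moreover have "inverse t + e\<^sup>2 = (t + (t * e)\<^sup>2) / t\<^sup>2"
        using t by (simp add: power2_eq_square field_simps)
      ultimately show ?case by (simp add: neck_N_def power_mult_distrib mult.commute)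
    qed
  qed
qed

lemma neck_dens_num_nonneg: "t \<ge> 0 \<Longrightarrow> neck_dens_num t \<ge> 0"
  unfolding neck_dens_num_def using cuts_sign[of t]
  by (smt (verit) mult_nonneg_nonneg mult_nonneg_nonpos zero_le_power2)

text \<open>With h the height of the unturned map on the sphere, the primitive is 2(h - 1) up to the
  neck and 2(1 - h) beyond it. It rises from -4 at the origin to 0 on the neck and tends to 4: each
  bubble covers the sphere once, contributing 4\<pi>.\<close>

lemma has_bochner_integral_neck_degree:
  "has_bochner_integral lborel (\<lambda>z. neck_map z \<bullet> cross3 (partial_y neck_map z) (partial_x neck_map z)) (8 * pi)"
proof -
  have F0: "4 * ((0 * outer_cut 0)\<^sup>2 - (inner_cut 0)\<^sup>2) / neck_N 0 = - 4"
    by (simp add: neck_N_def inner_cut_def log_scale_def smooth_step_eq_0)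
  have "has_bochner_integral lborel (\<lambda>z::complex. 4 * neck_dens_num ((cmod z)\<^sup>2) / (neck_N ((cmod z)\<^sup>2))\<^sup>2)
     (pi * (4 - 4 * ((0 * outer_cut 0)\<^sup>2 - (inner_cut 0)\<^sup>2) / neck_N 0))"
  proof (rule has_bochner_integral_radial_FTC[OF _ DERIV_neck_degree _ neck_degree_tendsto])
    show "(\<lambda>t. 4 * neck_dens_num t / (neck_N t)\<^sup>2) \<in> borel_measurable borel"
      unfolding neck_dens_num_def neck_N_def by measurable
  qed (auto simp: neck_dens_num_nonneg)
  then show ?thesis
    unfolding F0 neck_map_densities(2)[OF refl] neck_dens_num_eq[OF refl] by (simp add: mult.commute)
qed

lemma map_degree_neck_map: "map_degree neck_map = 2"
  using has_bochner_integral_neck_degree unfolding map_degree_def by (simp add: has_bochner_integral_iff)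

text \<open>The energy density is twice the degree density plus 16|\<beta>|^2/N^2. The first part
  integrates to 16\<pi>; the second is of order 1/l^2 against a logarithmic integral of length at
  most 5l, hence of order 1/l.\<close>

lemma neck_map_energy:
  "integrable lborel (grad_sq neck_map)" "dirichlet_energy neck_map \<le> 8 * pi + 40 * pi^3 / l"
proof -
  define dens where "dens = (\<lambda>z. neck_map z \<bullet> cross3 (partial_y neck_map z) (partial_x neck_map z))"
  define K where "K = (\<lambda>z::complex. pi\<^sup>2 / l\<^sup>2 / (1 + (cmod z)\<^sup>2) * indicator {0..exp (4 * l)} ((cmod z)\<^sup>2))"
  have K: "has_bochner_integral lborel K (pi * (pi\<^sup>2 / l\<^sup>2) * ln (1 + exp (4 * l)))"
    unfolding K_def by (rule has_bochner_integral_radial_inverse) auto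
  have d: "has_bochner_integral lborel dens (8 * pi)"
    unfolding dens_def by (rule has_bochner_integral_neck_degree)
  have B: "has_bochner_integral lborel (\<lambda>z. 2 * dens z + 16 * K z)
      (2 * (8 * pi) + 16 * (pi * (pi\<^sup>2 / l\<^sup>2) * ln (1 + exp (4 * l))))"
    by (intro has_bochner_integral_add has_bochner_integral_mult_right d K)
  have le: "grad_sq neck_map z \<le> 2 * dens z + 16 * K z" for z
  proof -
    have "grad_sq neck_map z = 2 * dens z + 16 * ((cmod (neck_\<beta> z ((cmod z)\<^sup>2)))\<^sup>2 / (neck_N ((cmod z)\<^sup>2))\<^sup>2)"
      unfolding dens_def neck_map_densities[OF refl] by (simp add: diff_divide_distrib add_divide_distrib)
    then show ?thesis using neck_\<beta>_bound[of "(cmod z)\<^sup>2" z, OF refl] unfolding K_def by linarith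
  qed
  show int: "integrable lborel (grad_sq neck_map)"
  proof (rule Bochner_Integration.integrable_bound)
    show "integrable lborel (\<lambda>z. 2 * dens z + 16 * K z)" using B by (simp add: has_bochner_integral_iff)
    show "grad_sq neck_map \<in> borel_measurable lborel"
      using borel_measurable_partials(3)[of neck_map, OF neck_map_differentiable[OF refl]] by simp
    show "AE z in lborel. norm (grad_sq neck_map z) \<le> norm (2 * dens z + 16 * K z)"
    proof (rule AE_I2)
      fix z
      have "0 \<le> grad_sq neck_map z" by (simp add: grad_sq_def)
      then show "norm (grad_sq neck_map z) \<le> norm (2 * dens z + 16 * K z)" using le[of z] by simp
    qed
  qed
  have "(\<integral>z. grad_sq neck_map z \<partial>lborel) \<le> (\<integral>z. 2 * dens z + 16 * K z \<partial>lborel)"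
    using B le by (intro integral_mono int) (auto simp: has_bochner_integral_iff)
  also have "\<dots> = 2 * (8 * pi) + 16 * (pi * (pi\<^sup>2 / l\<^sup>2) * ln (1 + exp (4 * l)))"
    using B by (simp add: has_bochner_integral_iff)
  also have "\<dots> \<le> 2 * (8 * pi) + 16 * (pi * (pi\<^sup>2 / l\<^sup>2) * (5 * l))"
  proof -
    have "1 + exp (4 * l) \<le> 2 * exp (4 * l)" using l by simp
    also have "\<dots> \<le> exp l * exp (4 * l)" using l exp_ge_add_one_self[of l] by (intro mult_right_mono) (linarith, simp)
    also have "\<dots> = exp (5 * l)" by (simp flip: exp_add)
    finally have "ln (1 + exp (4 * l)) \<le> 5 * l" by (metis add_pos_pos exp_gt_zero ln_exp ln_le_cancel_iff zero_less_one)
    then show ?thesis by (intro add_left_mono mult_left_mono) auto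
  qed
  also have "\<dots> = 2 * (8 * pi + 40 * pi^3 / l)"
    using l by (simp add: power2_eq_square power3_eq_cube)
  finally show "dirichlet_energy neck_map \<le> 8 * pi + 40 * pi^3 / l" unfolding dirichlet_energy_def by simp
qed

section \<open>The two bubbles and the distance from rational maps\<close>

lemma neck_map_inner:
  assumes "cmod z < 1"
  shows "neck_map z = hopf z 1"
proof -
  have "(cmod z)\<^sup>2 \<le> 1" using assms by (simp add: power_le_one)
  then have "1 + (cmod z)\<^sup>2 \<le> exp l" using l exp_ge_add_one_self[of l] by linarith
  then have "ln (1 + (cmod z)\<^sup>2) \<le> l" by (metis add_pos_nonneg ln_exp ln_le_cancel_iff exp_gt_zero zero_le_power2 zero_less_one)
  then have s: "log_scale ((cmod z)\<^sup>2) \<le> 1" using l by (simp add: log_scale_def)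
  then have "log_scale ((cmod z)\<^sup>2) \<le> 2" by simp
  from cuts_inner[OF this] s show ?thesis
    by (simp add: neck_map_def neck_P_def neck_Q_def neck_q_def inner_cut_def smooth_step_eq_0)
qed

text \<open>This is -z/L with L = exp(3l), with a common factor z kept in the pair. As exp(l) is at
  least 2, the radius L/2 is at least exp(2l), where \<open>log_scale\<close> has already reached
  4.\<close>

lemma neck_map_outer:
  assumes "exp (3 * l) / 2 < cmod z"
  shows "neck_map z = hopf (- (of_real (exp (- 3 * l)) * z\<^sup>2)) z"
proof -
  have "2 \<le> exp l" using l exp_ge_add_one_self[of l] by linarith
  then have "exp (2 * l) * 2 \<le> exp (2 * l) * exp l" by (intro mult_left_mono) auto
  also have "\<dots> = exp (3 * l)" by (simp flip: exp_add)
  finally have "exp (2 * l) \<le> cmod z" using assms by linarith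
  then have "(exp (2 * l))\<^sup>2 \<le> (cmod z)\<^sup>2" by (intro power_mono) auto
  moreover have "(exp (2 * l))\<^sup>2 = exp (4 * l)" by (simp add: power2_eq_square flip: exp_add)
  ultimately have s: "log_scale ((cmod z)\<^sup>2) \<ge> 4" by (intro outer_log_scale) simp
  then have "log_scale ((cmod z)\<^sup>2) \<ge> 3" by simp
  note c = cuts_outer[OF this]
  have "cos (angle ((cmod z)\<^sup>2)) = 0" "sin (angle ((cmod z)\<^sup>2)) = 1" unfolding c(3) by simp_all
  with c(1) s show ?thesis
    by (simp add: neck_map_def neck_P_def neck_Q_def neck_q_def outer_cut_def smooth_step_eq_1)
qed

text \<open>The two bubbles give the hypotheses of \<open>integral_ge_scaled_defect\<close> at scale
  1 with s = 1 and at scale L with s = -1. By \<open>scaled_defect_two_scales\<close> one of the two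
  defects is large, and 102400 is 256 times 400.\<close>

lemma neck_map_distance:
  assumes pq: "(p, q) \<in> A2"
  shows "(\<integral>z. grad_sq (\<lambda>w. neck_map w - stereo_rat p q w) z \<partial>lborel) \<ge> pi / 102400"
proof -
  define G where "G = grad_sq (\<lambda>w. neck_map w - stereo_rat p q w)"
  define N where "N = (\<lambda>z. (cmod (poly p z))\<^sup>2 + (cmod (poly q z))\<^sup>2)"
  have N: "N z > 0" for z unfolding N_def using sum_cmod_sq_pos[OF A2_D(4)[OF pq]] .
  have int: "integrable lborel G" unfolding G_def
    using neck_map_differentiable[OF refl] neck_map_energy(1) stereo_rat_differentiable[OF pq] integrable_grad_sq_stereo_rat[OF pq]
    by (intro integrable_grad_sq_diff)
  have pos: "G z \<ge> 0" for z unfolding G_def grad_sq_def by simp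
  have diff: "(\<lambda>w. neck_map w - stereo_rat p q w) differentiable (at z)" for z
    using neck_map_differentiable[OF refl] stereo_rat_differentiable[OF pq] by (intro differentiable_diff)
  have inner: "G z \<ge> (cmod (z / of_real 1 * poly q z - 1 * poly p z))\<^sup>2 / (1\<^sup>2 * N z)" if "cmod z < 1" for z
  proof -
    have "G z = grad_sq (\<lambda>w. hopf w 1 - hopf (poly p w) (poly q w)) z"
      unfolding G_def A2_D(5)[OF pq]
      by (rule grad_sq_cong_open[of "ball 0 1"]) (use that diff[unfolded A2_D(5)[OF pq]] neck_map_inner in auto)
    also have "\<dots> \<ge> 8 * (cmod (1 * 1 - z * 0))\<^sup>2 / ((cmod z)\<^sup>2 + (cmod 1)\<^sup>2)^3 * (cmod (z * poly q z - poly p z * 1))\<^sup>2 / N z"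
      unfolding N_def by (rule grad_sq_diff_hopf_ge) (use A2_D(4)[OF pq] in \<open>auto intro!: derivative_eq_intros poly_DERIV\<close>)
    finally have ge: "8 / ((cmod z)\<^sup>2 + 1)^3 * (cmod (z * poly q z - poly p z))\<^sup>2 / N z \<le> G z" by simp
    \<comment> \<open>On the unit disc the cube is at most 8, which cancels the factor 8 of the
      pointwise estimate.\<close>
    have "((cmod z)\<^sup>2 + 1)^3 \<le> (1 + 1)^3" using that by (intro power_mono add_right_mono) (auto simp: power_le_one)
    then have "1 \<le> 8 / ((cmod z)\<^sup>2 + 1)^3" by (simp add: le_divide_eq add_nonneg_pos)
    then have "1 * (cmod (z * poly q z - poly p z))\<^sup>2 / N z \<le> 8 / ((cmod z)\<^sup>2 + 1)^3 * (cmod (z * poly q z - poly p z))\<^sup>2 / N z"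
      using N[of z] by (intro divide_right_mono mult_right_mono) auto
    then show ?thesis using ge by simp
  qed
  define L e where "L = exp (3 * l)" and "e = exp (- 3 * l)"
  have Le: "L = 1 / e" "e > 0" unfolding L_def e_def by (simp_all add: exp_minus inverse_eq_divide)
  have outer: "G z \<ge> (cmod (z / of_real L * poly q z - (- 1) * poly p z))\<^sup>2 / (L\<^sup>2 * N z)" if z: "L / 2 < cmod z" "cmod z < L" for z
  proof -
    define r where "r = (cmod (of_real e * z * poly q z + poly p z))\<^sup>2"
    have z0: "cmod z > 0" using z(1) Le by (smt (verit) divide_pos_pos zero_less_one)
    have "G z = grad_sq (\<lambda>w. hopf (- (of_real e * w\<^sup>2)) w - hopf (poly p w) (poly q w)) z"
      unfolding G_def A2_D(5)[OF pq]
    proof (rule grad_sq_cong_open[of "- cball 0 (L / 2)"])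
      show "neck_map w - hopf (poly p w) (poly q w) = hopf (- (of_real e * w\<^sup>2)) w - hopf (poly p w) (poly q w)"
        if "w \<in> - cball 0 (L / 2)" for w
        using neck_map_outer[of w] that unfolding L_def e_def by simp
    qed (use z diff[unfolded A2_D(5)[OF pq]] in auto)
    also have "\<dots> \<ge> 8 * (cmod (z * (- (of_real e * (2 * z))) - (- (of_real e * z\<^sup>2)) * 1))\<^sup>2
        / ((cmod (- (of_real e * z\<^sup>2)))\<^sup>2 + (cmod z)\<^sup>2)^3
        * (cmod (- (of_real e * z\<^sup>2) * poly q z - poly p z * z))\<^sup>2 / N z"
      unfolding N_def
      by (rule grad_sq_diff_hopf_ge) (use A2_D(4)[OF pq] z0 in \<open>auto intro!: derivative_eq_intros poly_DERIV\<close>)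
    also have "z * (- (of_real e * (2 * z))) - (- (of_real e * z\<^sup>2)) * 1 = - (of_real e * z\<^sup>2)"
      by (simp add: power2_eq_square)
    also have "- (of_real e * z\<^sup>2) * poly q z - poly p z * z = - (z * (of_real e * z * poly q z + poly p z))"
      by (simp add: power2_eq_square algebra_simps)
    finally have ge: "8 * (e * (cmod z)\<^sup>2)\<^sup>2 / ((e * (cmod z)\<^sup>2)\<^sup>2 + (cmod z)\<^sup>2)^3 * ((cmod z)\<^sup>2 * r) / N z \<le> G z"
      using Le(2) by (simp add: r_def norm_mult norm_power power_mult_distrib)
    have "(e * (cmod z)\<^sup>2)\<^sup>2 + (cmod z)\<^sup>2 = (cmod z)\<^sup>2 * ((e * cmod z)\<^sup>2 + 1)"
      by (simp add: power2_eq_square algebra_simps)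
    \<comment> \<open>The powers of the common factor z cancel, leaving the estimate for the linear
      map -e z in lowest terms.\<close>
    then have "8 * (e * (cmod z)\<^sup>2)\<^sup>2 / ((e * (cmod z)\<^sup>2)\<^sup>2 + (cmod z)\<^sup>2)^3 * ((cmod z)\<^sup>2 * r) / N z
        = 8 / ((e * cmod z)\<^sup>2 + 1)^3 * (e\<^sup>2 * r) / N z"
      using z0 by (simp add: power_mult_distrib) (simp add: eval_nat_numeral mult.assoc)
    then have ge': "8 / ((e * cmod z)\<^sup>2 + 1)^3 * (e\<^sup>2 * r) / N z \<le> G z" using ge by simp
    have "e * cmod z < 1" using z(2) Le by (simp add: field_simps)
    then have "((e * cmod z)\<^sup>2 + 1)^3 \<le> (1 + 1)^3" using Le by (intro power_mono add_right_mono) (auto simp: power_le_one)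
    then have "1 \<le> 8 / ((e * cmod z)\<^sup>2 + 1)^3" by (simp add: le_divide_eq add_nonneg_pos)
    then have "1 * (e\<^sup>2 * r) / N z \<le> 8 / ((e * cmod z)\<^sup>2 + 1)^3 * (e\<^sup>2 * r) / N z"
      using N[of z] by (intro divide_right_mono mult_right_mono) (auto simp: r_def)
    then have "e\<^sup>2 * r / N z \<le> G z" using ge' by linarith
    moreover have "(cmod (z / of_real L * poly q z - (- 1) * poly p z))\<^sup>2 / (L\<^sup>2 * N z) = e\<^sup>2 * r / N z"
      unfolding Le(1) r_def using Le(2) by (simp add: mult.commute power_divide)
    ultimately show ?thesis by simp
  qed
  have "L \<ge> 10"
  proof -
    have "2 \<le> exp l" using l exp_ge_add_one_self[of l] by linarith
    have "exp 3 \<le> L" unfolding L_def using l by simp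
    moreover have "(10::real) \<le> exp 3"
    proof -
      have "(5/2::real) \<le> exp 1" using exp_lower_Taylor_quadratic[of "1::real"] by simp
      then have "(5/2)^3 \<le> (exp 1 :: real)^3" by (intro power_mono) auto
      also have "\<dots> = exp 3" by (simp add: exp_of_nat_mult[symmetric])
      finally show ?thesis by (simp add: power3_eq_cube)
    qed
    ultimately show ?thesis by linarith
  qed
  then have "scaled_defect 1 1 p q \<ge> scaled_size 1 p q / 400 \<or> scaled_defect L (- 1) p q \<ge> scaled_size L p q / 400"
    by (rule scaled_defect_two_scales) auto
  moreover have fin: "pi / 102400 \<le> pi / 256 * (S / n)" if "n / 400 \<le> S" "n > 0" for S n :: real
  proof -
    have "1 / 400 \<le> S / n" using that by (simp add: field_simps)
    then have "pi / 256 * (1 / 400) \<le> pi / 256 * (S / n)" by (intro mult_left_mono) auto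
    then show ?thesis by simp
  qed
  moreover have "pi / 256 * (scaled_defect 1 1 p q / scaled_size 1 p q) \<le> (\<integral>z. G z \<partial>lborel)"
    by (rule integral_ge_scaled_defect[OF pq _ int pos]) (use inner in \<open>auto simp: N_def\<close>)
  moreover have "pi / 256 * (scaled_defect L (- 1) p q / scaled_size L p q) \<le> (\<integral>z. G z \<partial>lborel)"
    by (rule integral_ge_scaled_defect[OF pq _ int pos]) (use outer \<open>L \<ge> 10\<close> in \<open>auto simp: N_def\<close>)
  ultimately show ?thesis
    unfolding G_def using scaled_size_pos[OF pq, of 1] scaled_size_pos[OF pq, of L] \<open>L \<ge> 10\<close>
    by (smt (verit))
qed

end

theorem theorem1p5:
  fixes M :: real
  assumes "M > 0"
  shows "\<exists>u :: complex \<Rightarrow> real^3.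
           (\<forall>z. u z \<in> sphere 0 1) \<and>
           (\<forall>z. u differentiable (at z)) \<and>
           integrable lborel (grad_sq u) \<and>
           integrable lborel (\<lambda>z. u z \<bullet> cross3 (partial_y u z) (partial_x u z)) \<and>
           map_degree u = 2 \<and>
           (\<forall>(p, q) \<in> A2.
              (\<integral>z. grad_sq (\<lambda>w. u w - stereo_rat p q w) z \<partial>lborel)
                > M * (dirichlet_energy u - 8 * pi))"
proof -
  \<comment> \<open>Makes \<open>M\<close> times the excess 40\<pi>^3/l at most half of the distance
    bound \<pi>/102400, so that the final inequality is strict; the maximum with 1 meets the locale
    assumption.\<close>
  define l where "l = max 1 (M * (40 * pi^3) / (pi / 204800))"
  interpret neck l by unfold_locales (simp add: l_def)
  have l: "l \<ge> 1" by (simp add: l_def)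
  have "M * (40 * pi^3) / (pi / 204800) \<le> l" by (simp add: l_def)
  then have "M * (40 * pi^3) \<le> l * (pi / 204800)" using pi_gt_zero by (subst (asm) pos_divide_le_eq) auto
  then have "M * (40 * pi^3 / l) \<le> pi / 204800" using l by (simp add: field_simps)
  also have "\<dots> < pi / 102400" by simp
  finally have small: "M * (40 * pi^3 / l) < pi / 102400" .
  have "M * (dirichlet_energy neck_map - 8 * pi) \<le> M * (40 * pi^3 / l)"
    using neck_map_energy(2) assms by (intro mult_left_mono) auto
  then have "M * (dirichlet_energy neck_map - 8 * pi) < (\<integral>z. grad_sq (\<lambda>w. neck_map w - stereo_rat p q w) z \<partial>lborel)"
    if "(p, q) \<in> A2" for p q
    using small neck_map_distance[OF that] by linarith
  moreover have "neck_map z \<in> sphere 0 1" for z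
    unfolding neck_map_def using norm_hopf[OF neck_nz] by simp
  moreover have "integrable lborel (\<lambda>z. neck_map z \<bullet> cross3 (partial_y neck_map z) (partial_x neck_map z))"
    using has_bochner_integral_neck_degree by (simp add: has_bochner_integral_iff)
  ultimately show ?thesis
    using neck_map_differentiable[OF refl] neck_map_energy(1) map_degree_neck_map by (intro exI[of _ neck_map]) auto
qed

end
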